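(* Let $\mathcal{A}$ be a properly infinite von Neumann algebra (acting on a Hilbert space $H$) and let $T\in\mathcal{A}$. Then the following statements hold. 1) $T$ is upper semi-$\mathcal{A}$-Weyl if and only if there exist some $S\in\mathcal{A}$ and $F\in\mathfrak{m}$ such that $S$ is bounded below and $T=S+F$. 2) $T$ is lower semi-$\mathcal{A}$-Weyl if and only if there exist some $S\in\mathcal{A}$ and $F\in\mathfrak{m}$ such that $S$ is surjective and $T=S+F$. 3) $T$ is $\mathcal{A}$-Weyl if and only if there exist some $S\in\mathcal{A}$ and $F\in\mathfrak{m}$ such that $S$ is invertible and $T=S+F$.
   Context: $\mathrm{Proj}_0(\mathcal{A})$ is the set of finite projections of $\mathcal{A}$ (projections not Murray-von Neumann equivalent to any proper subprojection). $\mathfrak{m}$ is the norm closure of the set of all $S\in\mathcal{A}$ such that the projection onto $\overline{\operatorname{Im}S}$ belongs to $\mathrm{Proj}_0(\mathcal{A})$; it is a selfadjoint ideal of $\mathcal{A}$. For projections $P,Q\in\mathcal{A}$: $P\sim Q$ means there is $V\in\mathcal{A}$ with $VV^*=P$, $V^*V=Q$; $P\preceq Q$ means there is a projection $P'\in\mathcal{A}$ with $P'\le Q$ and $P\sim P'$. $T\in\mathcal{A}$ is invertible up to the pair $(P,Q)$ of projections in $\mathcal{A}$ if, with $T'=(I-Q)T(I-P)$, there is $B\in\mathcal{A}$ with $B=(I-P)B(I-Q)$, $T'B=I-Q$, $BT'=I-P$. $T$ is upper semi-$\mathcal{A}$-Weyl, resp. lower semi-$\mathcal{A}$-Weyl,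 resp. $\mathcal{A}$-Weyl, if there are projections $P,Q\in\mathcal{A}$ such that $T$ is invertible up to $(P,Q)$ and $P\in\mathrm{Proj}_0(\mathcal{A})$, $P\preceq Q$, resp. $Q\in\mathrm{Proj}_0(\mathcal{A})$, $Q\preceq P$, resp. $P,Q\in\mathrm{Proj}_0(\mathcal{A})$, $P\sim Q$. *)

theory Defs
  imports "HOL-Analysis.Analysis"
begin

text \<open>
  Complex inner product spaces, conjugate-linear in the first argument. The underlying real inner
  product is the real part of the complex one, so that norm and topology are those of the
  class \<^class>\<open>real_inner\<close>; positive definiteness of \<open>cinner\<close> is inherited through
  \<open>inner_eq_Re_cinner\<close>.
\<close>

class complex_inner = real_inner +
  fixes scaleC :: "complex \<Rightarrow> 'a \<Rightarrow> 'a" (infixr \<open>*\<^sub>C\<close> 75)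
    and cinner :: "'a \<Rightarrow> 'a \<Rightarrow> complex"
  assumes scaleC_add_right: "c *\<^sub>C (x + y) = c *\<^sub>C x + c *\<^sub>C y"
    and scaleC_add_left: "(c + d) *\<^sub>C x = c *\<^sub>C x + d *\<^sub>C x"
    and scaleC_scaleC: "c *\<^sub>C d *\<^sub>C x = (c * d) *\<^sub>C x"
    and scaleC_of_real: "complex_of_real r *\<^sub>C x = r *\<^sub>R x"
    and cinner_commute: "cinner x y = cnj (cinner y x)"
    and cinner_add_left: "cinner (x + y) z = cinner x z + cinner y z"
    and cinner_scaleC_left: "cinner (c *\<^sub>C x) y = cnj c * cinner x y"
    and inner_eq_Re_cinner: "x \<bullet> y = Re (cinner x y)"

class chilbert_space = complex_inner + complete_space

instantiation complex :: chilbert_space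
begin

definition scaleC_complex :: "complex \<Rightarrow> complex \<Rightarrow> complex" where
  "scaleC_complex c x = c * x"

definition cinner_complex :: "complex \<Rightarrow> complex \<Rightarrow> complex" where
  "cinner_complex x y = cnj x * y"

instance
  by standard
    (auto simp: scaleC_complex_def cinner_complex_def algebra_simps scaleR_conv_of_real
      inner_complex_def)

end

text \<open>
  The type \<^typ>\<open>'a \<Rightarrow>\<^sub>L 'a\<close> consists of the bounded real-linear operators; \<open>bounded_ops\<close> is
  $B(H)$, with the operator norm inherited from that type.
\<close>

definition bounded_ops :: "('a::chilbert_space \<Rightarrow>\<^sub>L 'a) set" where
  "bounded_ops = {T. \<forall>c x. blinfun_apply T (c *\<^sub>C x) = c *\<^sub>C blinfun_apply T x}"

definition adj :: "('a::chilbert_space \<Rightarrow>\<^sub>L 'a) \<Rightarrow> ('a \<Rightarrow>\<^sub>L 'a)" where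
  "adj T = (THE S. \<forall>x y. cinner (blinfun_apply T x) y = cinner x (blinfun_apply S y))"

definition commutant :: "('a::chilbert_space \<Rightarrow>\<^sub>L 'a) set \<Rightarrow> ('a \<Rightarrow>\<^sub>L 'a) set" where
  "commutant M = {T \<in> bounded_ops. \<forall>S\<in>M. T o\<^sub>L S = S o\<^sub>L T}"

text \<open>
  A selfadjoint set of operators equal to its bicommutant. The unital subalgebra properties
  follow from the last condition, see the lemmas below.
\<close>

definition von_neumann_algebra :: "('a::chilbert_space \<Rightarrow>\<^sub>L 'a) set \<Rightarrow> bool" where
  "von_neumann_algebra A \<longleftrightarrow>
     A \<subseteq> bounded_ops \<and> (\<forall>T\<in>A. adj T \<in> A) \<and> commutant (commutant A) = A"

lemma blinfun_eq_pointwise: "S = T \<longleftrightarrow> (\<forall>x. blinfun_apply S x = blinfun_apply T x)"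
  by (auto intro: blinfun_eqI)

lemma commutant_id: "id_blinfun \<in> commutant M"
  by (auto simp: commutant_def bounded_ops_def intro!: blinfun_eqI)

lemma commutant_add: "S \<in> commutant M \<Longrightarrow> T \<in> commutant M \<Longrightarrow> S + T \<in> commutant M"
  by (auto simp: commutant_def bounded_ops_def scaleC_add_right blinfun.bilinear_simps
      blinfun_eq_pointwise)

lemma commutant_compose: "S \<in> commutant M \<Longrightarrow> T \<in> commutant M \<Longrightarrow> S o\<^sub>L T \<in> commutant M"
  by (auto simp: commutant_def bounded_ops_def blinfun_eq_pointwise)

lemma commutant_scaleC:
  assumes "M \<subseteq> bounded_ops" "T \<in> commutant M"
    and "\<And>x. blinfun_apply S x = c *\<^sub>C blinfun_apply T x"
  shows "S \<in> commutant M"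
  using assms by (auto simp: commutant_def bounded_ops_def blinfun_eq_pointwise scaleC_scaleC mult.commute)

lemma von_neumann_algebra_subalgebra:
  assumes "von_neumann_algebra A"
  shows "id_blinfun \<in> A"
    and "S \<in> A \<Longrightarrow> T \<in> A \<Longrightarrow> S + T \<in> A"
    and "S \<in> A \<Longrightarrow> T \<in> A \<Longrightarrow> S o\<^sub>L T \<in> A"
    and "T \<in> A \<Longrightarrow> (\<And>x. blinfun_apply S x = c *\<^sub>C blinfun_apply T x) \<Longrightarrow> S \<in> A"
proof -
  have A: "commutant (commutant A) = A" and B: "commutant A \<subseteq> bounded_ops"
    using assms by (auto simp: von_neumann_algebra_def commutant_def)
  show "id_blinfun \<in> A" using commutant_id A by metis
  show "S \<in> A \<Longrightarrow> T \<in> A \<Longrightarrow> S + T \<in> A" using commutant_add A by metis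
  show "S \<in> A \<Longrightarrow> T \<in> A \<Longrightarrow> S o\<^sub>L T \<in> A" using commutant_compose A by metis
  show "T \<in> A \<Longrightarrow> (\<And>x. blinfun_apply S x = c *\<^sub>C blinfun_apply T x) \<Longrightarrow> S \<in> A"
    using commutant_scaleC[OF B] A by metis
qed

definition Proj :: "('a::chilbert_space \<Rightarrow>\<^sub>L 'a) set \<Rightarrow> ('a \<Rightarrow>\<^sub>L 'a) set" where
  "Proj A = {P \<in> A. P o\<^sub>L P = P \<and> adj P = P}"

definition proj_le :: "('a::chilbert_space \<Rightarrow>\<^sub>L 'a) \<Rightarrow> ('a \<Rightarrow>\<^sub>L 'a) \<Rightarrow> bool" where
  "proj_le P Q \<longleftrightarrow> range (blinfun_apply P) \<subseteq> range (blinfun_apply Q)"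

definition mvn_equiv ::
    "('a::chilbert_space \<Rightarrow>\<^sub>L 'a) set \<Rightarrow> ('a \<Rightarrow>\<^sub>L 'a) \<Rightarrow> ('a \<Rightarrow>\<^sub>L 'a) \<Rightarrow> bool" where
  "mvn_equiv A P Q \<longleftrightarrow> (\<exists>V\<in>A. V o\<^sub>L adj V = P \<and> adj V o\<^sub>L V = Q)"

definition mvn_le ::
    "('a::chilbert_space \<Rightarrow>\<^sub>L 'a) set \<Rightarrow> ('a \<Rightarrow>\<^sub>L 'a) \<Rightarrow> ('a \<Rightarrow>\<^sub>L 'a) \<Rightarrow> bool" where
  "mvn_le A P Q \<longleftrightarrow> (\<exists>P'\<in>Proj A. proj_le P' Q \<and> mvn_equiv A P P')"

definition Proj0 :: "('a::chilbert_space \<Rightarrow>\<^sub>L 'a) set \<Rightarrow> ('a \<Rightarrow>\<^sub>L 'a) set" where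
  "Proj0 A = {P \<in> Proj A. \<not> (\<exists>P'\<in>Proj A. proj_le P' P \<and> P' \<noteq> P \<and> mvn_equiv A P P')}"

definition properly_infinite :: "('a::chilbert_space \<Rightarrow>\<^sub>L 'a) set \<Rightarrow> bool" where
  "properly_infinite A \<longleftrightarrow>
     (\<forall>P\<in>Proj A. (\<forall>T\<in>A. P o\<^sub>L T = T o\<^sub>L P) \<and> P \<noteq> 0 \<longrightarrow> P \<notin> Proj0 A)"

text \<open>
  An orthogonal projection is determined by its range, so the \<open>P\<close> below is the projection onto
  the closure of the image of \<open>S\<close>.
\<close>

definition fin_ideal :: "('a::chilbert_space \<Rightarrow>\<^sub>L 'a) set \<Rightarrow> ('a \<Rightarrow>\<^sub>L 'a) set" where
  "fin_ideal A = closure {S \<in> A. \<exists>P\<in>Proj0 A. range (blinfun_apply P) = closure (range (blinfun_apply S))}"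

definition invertible_up_to ::
    "('a::chilbert_space \<Rightarrow>\<^sub>L 'a) set \<Rightarrow> ('a \<Rightarrow>\<^sub>L 'a) \<Rightarrow> ('a \<Rightarrow>\<^sub>L 'a) \<Rightarrow> ('a \<Rightarrow>\<^sub>L 'a) \<Rightarrow> bool" where
  "invertible_up_to A T P Q \<longleftrightarrow>
     (let T' = (id_blinfun - Q) o\<^sub>L T o\<^sub>L (id_blinfun - P) in
        \<exists>B\<in>A. B = (id_blinfun - P) o\<^sub>L B o\<^sub>L (id_blinfun - Q) \<and>
          T' o\<^sub>L B = id_blinfun - Q \<and> B o\<^sub>L T' = id_blinfun - P)"

definition upper_semi_weyl :: "('a::chilbert_space \<Rightarrow>\<^sub>L 'a) set \<Rightarrow> ('a \<Rightarrow>\<^sub>L 'a) \<Rightarrow> bool" where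
  "upper_semi_weyl A T \<longleftrightarrow>
     (\<exists>P\<in>Proj A. \<exists>Q\<in>Proj A. invertible_up_to A T P Q \<and> P \<in> Proj0 A \<and> mvn_le A P Q)"

definition lower_semi_weyl :: "('a::chilbert_space \<Rightarrow>\<^sub>L 'a) set \<Rightarrow> ('a \<Rightarrow>\<^sub>L 'a) \<Rightarrow> bool" where
  "lower_semi_weyl A T \<longleftrightarrow>
     (\<exists>P\<in>Proj A. \<exists>Q\<in>Proj A. invertible_up_to A T P Q \<and> Q \<in> Proj0 A \<and> mvn_le A Q P)"

definition weyl :: "('a::chilbert_space \<Rightarrow>\<^sub>L 'a) set \<Rightarrow> ('a \<Rightarrow>\<^sub>L 'a) \<Rightarrow> bool" where
  "weyl A T \<longleftrightarrow>
     (\<exists>P\<in>Proj A. \<exists>Q\<in>Proj A. invertible_up_to A T P Q \<and>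
        P \<in> Proj0 A \<and> Q \<in> Proj0 A \<and> mvn_equiv A P Q)"

definition bounded_below :: "('a::chilbert_space \<Rightarrow>\<^sub>L 'a) \<Rightarrow> bool" where
  "bounded_below S \<longleftrightarrow> (\<exists>c>0. \<forall>x. c * norm x \<le> norm (blinfun_apply S x))"

definition invertible_in :: "('a::chilbert_space \<Rightarrow>\<^sub>L 'a) set \<Rightarrow> ('a \<Rightarrow>\<^sub>L 'a) \<Rightarrow> bool" where
  "invertible_in A S \<longleftrightarrow> (\<exists>R\<in>A. S o\<^sub>L R = id_blinfun \<and> R o\<^sub>L S = id_blinfun)"

end

theory Submission imports Defs begin

text \<open>
  Everything rests on the polar decomposition in \<open>A\<close>: the range projection of \<open>X \<in> A\<close> is equivalent
  to the projection onto the orthogonal complement of its kernel.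

  If \<open>T\<close> is invertible up to \<open>(P, Q)\<close> with inverse \<open>B\<close> and \<open>V\<^sup>*\<close> maps \<open>P H\<close> isometrically into \<open>Q H\<close>,
  then \<open>S = T (1 - P) + V\<^sup>*\<close> has the left inverse \<open>(B + V) (1 - Q T B)\<close>, which is two-sided if
  \<open>V\<^sup>*V = Q\<close>, and \<open>T - S\<close> vanishes on the kernel of the finite projection \<open>P\<close>.

  Conversely, being bounded below and being invertible are stable under small perturbations, so in
  \<open>T = S + F\<close> one may assume that \<open>F\<close> has finite range projection \<open>Q\<close>, hence also finite initial
  projection \<open>P\<close>. If \<open>S\<close> is invertible, \<open>T\<close> is invertible up to the projection onto \<open>S\<^sup>-\<^sup>1 Q H\<close> and \<open>Q\<close>.
  If \<open>S\<close> is bounded below, \<open>T\<close> agrees with \<open>S\<close> on \<open>(1 - P) H\<close>, and \<open>S\<close> embeds \<open>P H\<close> into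
  the quotient by \<open>S (1 - P) H\<close>. The surjective case is dual.
\<close>

instance chilbert_space \<subseteq> banach ..

section \<open>Orthogonal projections and adjoints\<close>

text \<open>Nearest-point argument: a sequence in \<open>M\<close> minimising the distance to
  \<open>x\<close> is Cauchy by the parallelogram law, and minimality of its limit forces
  orthogonality.\<close>

lemma orthogonal_decomposition_closed_subspace:
  fixes M :: "'a::{real_inner,complete_space} set"
  assumes M: "subspace M" and cl: "closed M"
  shows "\<exists>p\<in>M. \<forall>m\<in>M. (x - p) \<bullet> m = 0"
proof -
  define d where "d = infdist x M"
  have ne: "M \<noteq> {}" using subspace_0[OF M] by auto
  have dle: "d \<le> norm (x - m)" if "m \<in> M" for m
    using infdist_le[OF that, of x] by (simp add: d_def dist_norm)
  have d0: "d \<ge> 0" by (simp add: d_def infdist_nonneg)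
  have "\<exists>m\<in>M. norm (x - m) < d + 1 / Suc n" for n :: nat
  proof -
    have "(INF a\<in>M. dist x a) < d + 1 / Suc n" using ne by (simp add: d_def infdist_notempty)
    then show ?thesis using cINF_greatest[OF ne, of "d + 1 / Suc n" "dist x"]
      by (force simp: dist_norm)
  qed
  then obtain m where m: "\<And>n. m n \<in> M" "\<And>n. norm (x - m n) < d + 1 / Suc n"
    by metis
  \<comment> \<open>The midpoint of \<open>m i\<close> and \<open>m j\<close> lies in
    \<open>M\<close>, hence at distance at least \<open>d\<close> from \<open>x\<close>; the
    parallelogram identity does the rest.\<close>
  have par: "(norm (m i - m j))\<^sup>2 \<le> 2 * (norm (x - m i))\<^sup>2 + 2 * (norm (x - m j))\<^sup>2 - 4 * d\<^sup>2" for i j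
  proof -
    have "(1/2) *\<^sub>R (m i + m j) \<in> M" using M m by (simp add: subspace_add subspace_scale)
    then have "d \<le> norm (x - (1/2) *\<^sub>R (m i + m j))" by (rule dle)
    then have "d\<^sup>2 \<le> (norm (x - (1/2) *\<^sub>R (m i + m j)))\<^sup>2" using d0 by (simp add: power_mono)
    then show ?thesis
      by (simp add: power2_norm_eq_inner inner_simps inner_commute algebra_simps)
  qed
  have "Cauchy m"
  proof (rule metric_CauchyI)
    fix e :: real assume e: "e > 0"
    have "(\<lambda>n. 4 * (d + 1 / Suc n)\<^sup>2 - 4 * d\<^sup>2) \<longlonglongrightarrow> 4 * (d + 0)\<^sup>2 - 4 * d\<^sup>2"
      by (intro tendsto_intros LIMSEQ_Suc[OF lim_1_over_n])
    then have "\<forall>\<^sub>F n in sequentially. 4 * (d + 1 / Suc n)\<^sup>2 - 4 * d\<^sup>2 < e\<^sup>2"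
      using e by (intro order_tendstoD(2)) auto
    then obtain N where N: "4 * (d + 1 / Suc N)\<^sup>2 - 4 * d\<^sup>2 < e\<^sup>2"
      by (auto simp: eventually_sequentially)
    have b: "(norm (x - m i))\<^sup>2 \<le> (d + 1 / Suc N)\<^sup>2" if "i \<ge> N" for i
    proof -
      have "1 / real (Suc i) \<le> 1 / real (Suc N)" using that by (simp add: frac_le)
      then show ?thesis using m(2)[of i] by (intro power_mono) auto
    qed
    have "dist (m i) (m j) < e" if "i \<ge> N" "j \<ge> N" for i j
    proof -
      have "(norm (m i - m j))\<^sup>2 < e\<^sup>2" using par[of i j] b[OF that(1)] b[OF that(2)] N by linarith
      then show ?thesis using e by (simp add: dist_norm power_less_imp_less_base)
    qed
    then show "\<exists>K. \<forall>i\<ge>K. \<forall>j\<ge>K. dist (m i) (m j) < e" by blast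
  qed
  then obtain p where p: "m \<longlonglongrightarrow> p" by (auto simp: Cauchy_convergent_iff convergent_def)
  have pM: "p \<in> M" using closed_sequentially[OF cl] m(1) p by blast
  have "norm (x - p) \<le> d + 0"
  proof (rule LIMSEQ_le)
    show "(\<lambda>n. norm (x - m n)) \<longlonglongrightarrow> norm (x - p)" by (intro tendsto_intros p)
    show "(\<lambda>n. d + 1 / Suc n) \<longlonglongrightarrow> d + 0" by (intro tendsto_intros LIMSEQ_Suc[OF lim_1_over_n])
    show "\<exists>N. \<forall>n\<ge>N. norm (x - m n) \<le> d + 1 / Suc n" using m(2) less_imp_le by blast
  qed
  then have np: "norm (x - p) \<le> norm (x - k)" if "k \<in> M" for k using dle[OF that] by simp
  have "(x - p) \<bullet> k = 0" if k: "k \<in> M" for k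
  proof (cases "k = 0")
    case False
    \<comment> \<open>This \<open>t\<close> minimises the norm of
      \<open>x - p - t *\<^sub>R k\<close>.\<close>
    define t where "t = ((x - p) \<bullet> k) / (k \<bullet> k)"
    have "p + t *\<^sub>R k \<in> M" using M pM k by (simp add: subspace_add subspace_scale)
    then have "(norm (x - p))\<^sup>2 \<le> (norm ((x - p) - t *\<^sub>R k))\<^sup>2"
      using np by (metis diff_diff_eq norm_ge_zero power_mono)
    also have "\<dots> = (norm (x - p))\<^sup>2 - ((x - p) \<bullet> k)\<^sup>2 / (k \<bullet> k)"
    proof -
      have "(norm (u - r *\<^sub>R k))\<^sup>2 = (norm u)\<^sup>2 - 2 * r * (u \<bullet> k) + r\<^sup>2 * (k \<bullet> k)" for u r
        unfolding power2_norm_eq_inner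
        by (simp add: inner_diff_left inner_diff_right inner_commute power2_eq_square)
      then show ?thesis using False by (simp add: t_def power2_eq_square)
    qed
    finally have "((x - p) \<bullet> k)\<^sup>2 / (k \<bullet> k) \<le> 0" by simp
    moreover have "k \<bullet> k > 0" using False by simp
    ultimately show ?thesis by (simp add: divide_le_0_iff)
  qed simp
  then show ?thesis using pM by blast
qed

text \<open>A nonzero \<open>f\<close> has a kernel of codimension one; a vector \<open>e\<close>
  orthogonal to the kernel, suitably scaled, represents \<open>f\<close>.\<close>

lemma riesz_representation:
  fixes f :: "'a::{real_inner,complete_space} \<Rightarrow> real"
  assumes "bounded_linear f"
  shows "\<exists>w. \<forall>x. f x = x \<bullet> w"
proof (cases "\<forall>x. f x = 0")
  case False
  interpret f: bounded_linear f by fact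
  obtain x0 where x0: "f x0 \<noteq> 0" using False by blast
  define M where "M = {x. f x = 0}"
  have sub: "subspace M" unfolding M_def
    by (auto simp: subspace_def f.add f.scaleR f.zero)
  have cl: "closed M" unfolding M_def
    by (intro closed_Collect_eq continuous_intros f.continuous_on)
  obtain p where p: "p \<in> M" "\<And>m. m \<in> M \<Longrightarrow> (x0 - p) \<bullet> m = 0"
    using orthogonal_decomposition_closed_subspace[OF sub cl, of x0] by blast
  define e where "e = x0 - p"
  have fe: "f e \<noteq> 0" using x0 p(1) by (simp add: e_def M_def f.diff)
  then have e0: "e \<bullet> e \<noteq> 0" using f.zero by auto
  have "f x = x \<bullet> ((f e / (e \<bullet> e)) *\<^sub>R e)" for x
  proof -
    have "x - (f x / f e) *\<^sub>R e \<in> M" using fe by (simp add: M_def f.diff f.scaleR)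
    then have "e \<bullet> (x - (f x / f e) *\<^sub>R e) = 0" using p(2) by (simp add: e_def)
    then have "x \<bullet> e = (f x / f e) * (e \<bullet> e)" by (simp add: inner_diff_right inner_commute)
    then show ?thesis using fe e0 by (simp add: field_simps)
  qed
  then show ?thesis by blast
qed (auto intro: exI[of _ 0])

text \<open>Riesz representation of \<open>x \<mapsto> T x \<bullet> y\<close> gives the value at
  \<open>y\<close>; uniqueness of the representing vector gives linearity, and testing at
  \<open>x = g y\<close> gives the bound.\<close>

lemma exists_real_adjoint:
  fixes T :: "'a::{real_inner,complete_space} \<Rightarrow>\<^sub>L 'a"
  shows "\<exists>S :: 'a \<Rightarrow>\<^sub>L 'a. \<forall>x y. T x \<bullet> y = x \<bullet> S y"
proof -
  have "\<exists>w. \<forall>x. T x \<bullet> y = x \<bullet> w" for y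
    by (rule riesz_representation) (intro bounded_linear_intros)
  then obtain g where g: "\<And>x y. T x \<bullet> y = x \<bullet> g y" by metis
  have "bounded_linear g"
  proof (rule bounded_linear_intro[where K = "norm T"])
    show "g (x + y) = g x + g y" for x y
      by (rule vector_eq_ldot[THEN iffD1]) (simp add: inner_add_right g[symmetric])
    show "g (r *\<^sub>R x) = r *\<^sub>R g x" for r x
      by (rule vector_eq_ldot[THEN iffD1]) (simp add: g[symmetric])
    show "norm (g y) \<le> norm y * norm T" for y
    proof (cases "g y = 0")
      case False
      have "norm (g y) * norm (g y) = T (g y) \<bullet> y"
        by (simp add: g power2_norm_eq_inner[symmetric] power2_eq_square)
      also have "\<dots> \<le> norm T * norm (g y) * norm y"
        by (meson norm_blinfun norm_cauchy_schwarz order_trans mult_right_mono norm_ge_zero)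
      finally show ?thesis using False by (simp add: mult.commute mult.left_commute)
    qed simp
  qed
  then show ?thesis using g by (intro exI[of _ "Blinfun g"]) (simp add: bounded_linear_Blinfun_apply)
qed

section \<open>Adjoints through the real inner product\<close>

lemma cinner_scaleC_right: "cinner x (c *\<^sub>C y) = c * cinner x y"
  by (metis cinner_commute cinner_scaleC_left complex_cnj_cnj complex_cnj_mult)

text \<open>The real inner product determines the complex one, so for complex linear operators an
  adjoint identity need only be checked for \<open>\<bullet>\<close>.\<close>

lemma cinner_eq_inner:
  "cinner x y = Complex (x \<bullet> y) (- (x \<bullet> (\<i> *\<^sub>C y)))" for x y :: "'a::complex_inner"
  by (simp add: inner_eq_Re_cinner complex_eq_iff cinner_scaleC_right)

text \<open>Multiplication by \<open>c\<close> has real adjoint multiplication by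
  \<open>cnj c\<close>. Hence the real adjoint of a complex linear operator is again complex linear
  and is the operator described in \<open>adj\<close>.\<close>

lemma inner_adj:
  fixes T :: "'a::chilbert_space \<Rightarrow>\<^sub>L 'a"
  assumes "T \<in> bounded_ops"
  shows "T x \<bullet> y = x \<bullet> adj T y"
    and "adj T x \<bullet> y = x \<bullet> T y"
    and "adj T \<in> bounded_ops"
proof -
  obtain S :: "'a \<Rightarrow>\<^sub>L 'a" where S: "\<And>x y. T x \<bullet> y = x \<bullet> S y"
    using exists_real_adjoint[of T] by blast
  have I: "(c *\<^sub>C x) \<bullet> y = x \<bullet> (cnj c *\<^sub>C y)" for c and x y :: 'a
    by (simp add: inner_eq_Re_cinner cinner_scaleC_left cinner_scaleC_right)
  have Sb: "S \<in> bounded_ops"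
    unfolding bounded_ops_def
  proof (clarify)
    fix c and y :: 'a
    show "S (c *\<^sub>C y) = c *\<^sub>C S y"
    proof (rule vector_eq_ldot[THEN iffD1], intro allI)
      fix x
      have "x \<bullet> S (c *\<^sub>C y) = T (cnj c *\<^sub>C x) \<bullet> y"
        using assms by (simp add: S[symmetric] I bounded_ops_def)
      also have "\<dots> = x \<bullet> (c *\<^sub>C S y)" by (simp add: S I)
      finally show "x \<bullet> S (c *\<^sub>C y) = x \<bullet> (c *\<^sub>C S y)" .
    qed
  qed
  have "adj T = S"
    unfolding adj_def
  proof (rule the_equality)
    show "\<forall>x y. cinner (T x) y = cinner x (S y)"
      using Sb by (simp add: cinner_eq_inner S bounded_ops_def)
    fix R :: "'a \<Rightarrow>\<^sub>L 'a" assume "\<forall>x y. cinner (T x) y = cinner x (R y)"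
    then have "x \<bullet> R y = x \<bullet> S y" for x y
      by (metis S inner_eq_Re_cinner)
    then show "R = S" by (metis blinfun_eqI vector_eq_ldot)
  qed
  then show "T x \<bullet> y = x \<bullet> adj T y"
    "adj T x \<bullet> y = x \<bullet> T y" "adj T \<in> bounded_ops"
    using S Sb by (auto simp: inner_commute)
qed

lemma adj_unique:
  fixes S T :: "'a::chilbert_space \<Rightarrow>\<^sub>L 'a"
  assumes "T \<in> bounded_ops" "\<And>x y. T x \<bullet> y = x \<bullet> S y"
  shows "adj T = S"
  using assms by (metis blinfun_eqI inner_adj(1) vector_eq_ldot)

lemma bounded_ops_closed:
  fixes S T :: "'a::chilbert_space \<Rightarrow>\<^sub>L 'a"
  shows "(id_blinfun :: 'a \<Rightarrow>\<^sub>L 'a) \<in> bounded_ops" "(0 :: 'a \<Rightarrow>\<^sub>L 'a) \<in> bounded_ops"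
    and "S \<in> bounded_ops \<Longrightarrow> T \<in> bounded_ops \<Longrightarrow> S + T \<in> bounded_ops"
    and "S \<in> bounded_ops \<Longrightarrow> T \<in> bounded_ops \<Longrightarrow> S - T \<in> bounded_ops"
    and "S \<in> bounded_ops \<Longrightarrow> T \<in> bounded_ops \<Longrightarrow> S o\<^sub>L T \<in> bounded_ops"
    and "S \<in> bounded_ops \<Longrightarrow> r *\<^sub>R S \<in> bounded_ops"
proof -
  have z: "c *\<^sub>C (0::'a) = 0" for c :: complex
    using scaleC_add_right[of c 0 "0::'a"] by simp
  have d: "c *\<^sub>C (x - y) = c *\<^sub>C x - c *\<^sub>C y" for c and x y :: 'a
    using scaleC_add_right[of c "x - y" y] by simp
  have r: "r *\<^sub>R c *\<^sub>C x = c *\<^sub>C r *\<^sub>R x" for c and x :: 'a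
    by (metis mult.commute scaleC_of_real scaleC_scaleC)
  show "(id_blinfun :: 'a \<Rightarrow>\<^sub>L 'a) \<in> bounded_ops" "(0 :: 'a \<Rightarrow>\<^sub>L 'a) \<in> bounded_ops"
    "S \<in> bounded_ops \<Longrightarrow> T \<in> bounded_ops \<Longrightarrow> S + T \<in> bounded_ops"
    "S \<in> bounded_ops \<Longrightarrow> T \<in> bounded_ops \<Longrightarrow> S - T \<in> bounded_ops"
    "S \<in> bounded_ops \<Longrightarrow> T \<in> bounded_ops \<Longrightarrow> S o\<^sub>L T \<in> bounded_ops"
    "S \<in> bounded_ops \<Longrightarrow> r *\<^sub>R S \<in> bounded_ops"
    by (auto simp: bounded_ops_def blinfun.bilinear_simps scaleC_add_right z d r)
qed

lemma adj_simps:
  fixes S T :: "'a::chilbert_space \<Rightarrow>\<^sub>L 'a"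
  shows "adj (id_blinfun :: 'a \<Rightarrow>\<^sub>L 'a) = id_blinfun"
    and "adj (0 :: 'a \<Rightarrow>\<^sub>L 'a) = 0"
    and "T \<in> bounded_ops \<Longrightarrow> adj (adj T) = T"
    and "S \<in> bounded_ops \<Longrightarrow> T \<in> bounded_ops \<Longrightarrow> adj (S + T) = adj S + adj T"
    and "S \<in> bounded_ops \<Longrightarrow> T \<in> bounded_ops \<Longrightarrow> adj (S - T) = adj S - adj T"
    and "S \<in> bounded_ops \<Longrightarrow> T \<in> bounded_ops \<Longrightarrow> adj (S o\<^sub>L T) = adj T o\<^sub>L adj S"
    and "T \<in> bounded_ops \<Longrightarrow> adj (r *\<^sub>R T) = r *\<^sub>R adj T"
proof -
  show "T \<in> bounded_ops \<Longrightarrow> adj (adj T) = T"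
    by (rule adj_unique) (simp_all add: inner_adj(2,3))
qed (rule adj_unique;
     simp add: bounded_ops_closed inner_adj(1) blinfun.bilinear_simps inner_simps)+

lemma norm_adj:
  fixes T :: "'a::chilbert_space \<Rightarrow>\<^sub>L 'a"
  assumes "T \<in> bounded_ops"
  shows "norm (adj T) = norm T"
proof -
  \<comment> \<open>The adjoint is an involution, so this inequality for both \<open>T\<close> and
    \<open>adj T\<close> gives equality.\<close>
  have *: "norm (adj T) \<le> norm T" if T: "T \<in> bounded_ops" for T :: "'a \<Rightarrow>\<^sub>L 'a"
  proof (rule norm_blinfun_bound)
    fix y
    show "norm (adj T y) \<le> norm T * norm y"
    proof (cases "adj T y = 0")
      case False
      let ?g = "adj T y"
      have "norm ?g * norm ?g = T ?g \<bullet> y"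
        by (simp add: inner_adj(1)[OF T] power2_norm_eq_inner[symmetric] power2_eq_square)
      also have "\<dots> \<le> norm T * norm ?g * norm y"
        by (meson norm_blinfun norm_cauchy_schwarz order_trans mult_right_mono norm_ge_zero)
      finally show ?thesis using False by (simp add: mult.commute mult.left_commute)
    qed simp
  qed simp
  show ?thesis using *[OF assms] *[OF inner_adj(3)[OF assms]] by (simp add: adj_simps assms)
qed


lemma closed_subspace_projection:
  fixes M :: "'a::{real_inner,complete_space} set"
  assumes M: "subspace M" and cl: "closed M"
  shows "\<exists>P :: 'a \<Rightarrow>\<^sub>L 'a. range P = M \<and> (\<forall>m\<in>M. P m = m) \<and>
           (\<forall>x. \<forall>m\<in>M. (x - P x) \<bullet> m = 0)"
proof -
  obtain p where p: "\<And>x. p x \<in> M" "\<And>x m. m \<in> M \<Longrightarrow> (x - p x) \<bullet> m = 0"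
    using orthogonal_decomposition_closed_subspace[OF M cl] by metis
  \<comment> \<open>Membership in \<open>M\<close> and a residual orthogonal to \<open>M\<close>
    characterise \<open>p x\<close>, so linearity follows by checking the candidate values.\<close>
  have uniq: "p x = q" if "q \<in> M" "\<And>m. m \<in> M \<Longrightarrow> (x - q) \<bullet> m = 0" for x q
  proof -
    have "p x - q \<in> M" using M p(1) that(1) by (simp add: subspace_diff)
    then have "(p x - q) \<bullet> (p x - q) = 0"
      using p(2)[of "p x - q" x] that(2)[of "p x - q"] by (simp add: inner_diff_left)
    then show ?thesis by simp
  qed
  have "bounded_linear p"
  proof (rule bounded_linear_intro[where K = 1])
    show "p (x + y) = p x + p y" for x y
      using M p(1) p(2)[of _ x] p(2)[of _ y]
      by (intro uniq) (auto simp: subspace_add inner_simps algebra_simps)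
    show "p (r *\<^sub>R x) = r *\<^sub>R p x" for r x
      using M p(1) p(2)[of _ x]
      by (intro uniq) (auto simp: subspace_scale inner_simps scaleR_right_diff_distrib[symmetric])
    show "norm (p x) \<le> norm x * 1" for x
    proof -
      have "p x \<bullet> p x = x \<bullet> p x" using p(2)[OF p(1)[of x], of x] by (simp add: inner_diff_left)
      then have "norm (p x) * norm (p x) \<le> norm x * norm (p x)"
        by (metis norm_cauchy_schwarz power2_eq_square power2_norm_eq_inner)
      then show ?thesis by (cases "p x = 0") auto
    qed
  qed
  moreover have "p m = m" if "m \<in> M" for m using that by (intro uniq) auto
  ultimately show ?thesis using p
    by (intro exI[of _ "Blinfun p"]) (auto simp: bounded_linear_Blinfun_apply, metis rangeI)
qed

section \<open>Operators in a von Neumann algebra\<close>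

locale vN_algebra =
  fixes A :: "('a::chilbert_space \<Rightarrow>\<^sub>L 'a) set"
  assumes vN: "von_neumann_algebra A"
begin

lemma bounded_op [simp]: "X \<in> A \<Longrightarrow> X \<in> bounded_ops"
  using vN by (auto simp: von_neumann_algebra_def)

text \<open>The commutant contains multiplication by \<open>\<i>\<close>, so complex linearity need not be checked
  separately.\<close>

lemma mem_iff_commutes: "X \<in> A \<longleftrightarrow> (\<forall>Y\<in>commutant A. \<forall>x. X (Y x) = Y (X x))"
proof
  assume "X \<in> A"
  then show "\<forall>Y\<in>commutant A. \<forall>x. X (Y x) = Y (X x)"
    by (auto simp: commutant_def blinfun_eq_pointwise)
next
  assume *: "\<forall>Y\<in>commutant A. \<forall>x. X (Y x) = Y (X x)"
  have "norm (\<i> *\<^sub>C x) = norm x" for x :: 'a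
  proof -
    have "cinner (\<i> *\<^sub>C x) (\<i> *\<^sub>C x) = cinner x x"
      by (simp add: cinner_scaleC_left cinner_scaleC_right)
    then show ?thesis by (simp add: norm_eq_sqrt_inner inner_eq_Re_cinner)
  qed
  moreover have "\<i> *\<^sub>C (r *\<^sub>R x) = r *\<^sub>R (\<i> *\<^sub>C x)" for r and x :: 'a
    by (metis mult.commute scaleC_of_real scaleC_scaleC)
  ultimately have bl: "bounded_linear (\<lambda>x::'a. \<i> *\<^sub>C x)"
    by (intro bounded_linear_intro[where K = 1]) (auto simp: scaleC_add_right)
  have app: "(Blinfun (\<lambda>x::'a. \<i> *\<^sub>C x)) x = \<i> *\<^sub>C x" for x
    by (simp add: bounded_linear_Blinfun_apply[OF bl])
  have "Blinfun (\<lambda>x. \<i> *\<^sub>C x) \<in> commutant A"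
    unfolding commutant_def bounded_ops_def using bounded_op
    by (auto simp: blinfun_eq_pointwise app bounded_ops_def scaleC_scaleC mult.commute)
  then have i: "X (\<i> *\<^sub>C x) = \<i> *\<^sub>C X x" for x
    using * by (force simp: app)
  \<comment> \<open>Given real linearity, commuting with \<open>\<i>\<close> yields commuting with
    every complex scalar.\<close>
  have dec: "c *\<^sub>C x = Re c *\<^sub>R x + Im c *\<^sub>R (\<i> *\<^sub>C x)" for c and x :: 'a
  proof -
    have "c *\<^sub>C x = (complex_of_real (Re c) + complex_of_real (Im c) * \<i>) *\<^sub>C x"
      by (metis complex_eq mult.commute)
    then show ?thesis by (metis scaleC_add_left scaleC_of_real scaleC_scaleC)
  qed
  have "X \<in> bounded_ops"
    unfolding bounded_ops_def mem_Collect_eq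
    by (subst dec, subst (2) dec) (simp add: blinfun.bilinear_simps i)
  then have "X \<in> commutant (commutant A)"
    using * by (auto simp: commutant_def blinfun_eq_pointwise)
  then show "X \<in> A" using vN by (simp add: von_neumann_algebra_def)
qed

lemma mem_closed [simp]:
  shows "id_blinfun \<in> A" "0 \<in> A"
    and "S \<in> A \<Longrightarrow> T \<in> A \<Longrightarrow> S + T \<in> A"
    and "S \<in> A \<Longrightarrow> T \<in> A \<Longrightarrow> S - T \<in> A"
    and "S \<in> A \<Longrightarrow> T \<in> A \<Longrightarrow> S o\<^sub>L T \<in> A"
    and "S \<in> A \<Longrightarrow> r *\<^sub>R S \<in> A"
    and "S \<in> A \<Longrightarrow> adj S \<in> A"
  using vN by (auto simp: mem_iff_commutes blinfun.bilinear_simps von_neumann_algebra_def)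

text \<open>Take adjoints of the commutation relation with \<open>adj S\<close>. This makes
  commutant-invariant subspaces reducing.\<close>

lemma commutant_adj: "Y \<in> commutant A \<Longrightarrow> adj Y \<in> commutant A"
proof -
  assume Y: "Y \<in> commutant A"
  then have Yb: "Y \<in> bounded_ops" by (simp add: commutant_def)
  have "adj Y o\<^sub>L S = S o\<^sub>L adj Y" if S: "S \<in> A" for S
  proof -
    have "Y o\<^sub>L adj S = adj S o\<^sub>L Y" using Y S by (simp add: commutant_def)
    then have "adj (Y o\<^sub>L adj S) = adj (adj S o\<^sub>L Y)" by simp
    then show ?thesis using Yb S by (simp add: adj_simps inner_adj(3))
  qed
  then show ?thesis using Yb by (simp add: commutant_def inner_adj(3))
qed

text \<open>The bicommutant description exhibits \<open>A\<close> as an intersection of closed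
  conditions on \<open>X\<close>.\<close>

lemma closed_algebra: "closed A"
proof -
  have closed_eq: "closed {X :: 'a \<Rightarrow>\<^sub>L 'a. X (Y x) = Y (X x)}"
    for x and Y :: "'a \<Rightarrow>\<^sub>L 'a"
    by (intro closed_Collect_eq continuous_intros)
  have *: "A = (\<Inter>Y\<in>commutant A. \<Inter>x. {X :: 'a \<Rightarrow>\<^sub>L 'a. X (blinfun_apply Y x) = blinfun_apply Y (X x)})"
    using mem_iff_commutes by auto
  show ?thesis
    by (subst *) (intro closed_INT ballI closed_eq)
qed

lemma Proj_D:
  assumes "P \<in> Proj A"
  shows "P \<in> A" "P (P x) = P x"
    "P x \<bullet> y = x \<bullet> P y" "adj P = P"
    "x \<in> range P \<longleftrightarrow> P x = x"
proof -
  show a: "P \<in> A" "adj P = P" using assms by (auto simp: Proj_def)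
  show b: "P (P x) = P x" for x
    using assms by (auto simp: Proj_def blinfun_eq_pointwise)
  show "P x \<bullet> y = x \<bullet> P y" using a inner_adj(1)[of P] by simp
  show "x \<in> range P \<longleftrightarrow> P x = x" using b by (metis rangeE rangeI)
qed

lemma Proj_I:
  assumes "P \<in> A" "\<And>x. P (P x) = P x"
    "\<And>x y. P x \<bullet> y = x \<bullet> P y"
  shows "P \<in> Proj A"
  using assms adj_unique[of P P] by (auto simp: Proj_def blinfun_eq_pointwise)

lemma closed_range_Proj: "P \<in> Proj A \<Longrightarrow> closed (range P)"
proof -
  assume P: "P \<in> Proj A"
  have "range P = {x. P x = x}" using Proj_D(5)[OF P] by blast
  then show ?thesis by (simp add: closed_Collect_eq linear_continuous_on blinfun.bounded_linear_right)
qed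

lemma Proj_compl: "P \<in> Proj A \<Longrightarrow> id_blinfun - P \<in> Proj A"
  using Proj_D by (intro Proj_I) (auto simp: blinfun.bilinear_simps inner_simps)

lemma proj_le_D:
  assumes "P \<in> Proj A" "Q \<in> Proj A" "proj_le P Q"
  shows "Q (P x) = P x"
    "P (Q x) = P x"
proof -
  show a: "Q (P x) = P x" for x
    using assms Proj_D(5)[OF assms(2)] by (auto simp: proj_le_def)
  show "P (Q x) = P x"
    by (rule vector_eq_ldot[THEN iffD1]) (simp add: Proj_D(3)[OF assms(1), symmetric] Proj_D(3)[OF assms(2), symmetric] a)
qed

text \<open>Kernels are what the polar decomposition delivers. Applying the kernel condition to
  \<open>x - Q x\<close> gives \<open>P Q = P\<close>, whose adjoint is
  \<open>Q P = P\<close>.\<close>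

lemma proj_le_iff_ker:
  assumes P: "P \<in> Proj A" and Q: "Q \<in> Proj A"
  shows "proj_le P Q \<longleftrightarrow> (\<forall>x. Q x = 0 \<longrightarrow> P x = 0)"
proof
  assume "proj_le P Q"
  then show "\<forall>x. Q x = 0 \<longrightarrow> P x = 0"
    using proj_le_D(2)[OF P Q] by (metis blinfun.zero_right)
next
  assume *: "\<forall>x. Q x = 0 \<longrightarrow> P x = 0"
  have PQ: "P (Q x) = P x" for x
    using *[rule_format, of "x - Q x"] by (simp add: blinfun.bilinear_simps Proj_D(2)[OF Q])
  have "Q (P x) = P x" for x
    by (rule vector_eq_ldot[THEN iffD1]) (simp add: Proj_D(3)[OF P, symmetric] Proj_D(3)[OF Q, symmetric] PQ)
  then show "proj_le P Q" unfolding proj_le_def by (metis image_subset_iff rangeI)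
qed

lemma proj_le_antisym:
  assumes "P \<in> Proj A" "Q \<in> Proj A" "proj_le P Q" "proj_le Q P"
  shows "P = Q"
  using proj_le_D[OF assms(1,2,3)] proj_le_D[OF assms(2,1,4)] by (intro blinfun_eqI) metis

lemma Proj_eqI_ker:
  assumes "P \<in> Proj A" "Q \<in> Proj A" "\<And>x. P x = 0 \<longleftrightarrow> Q x = 0"
  shows "P = Q"
  by (rule proj_le_antisym[OF assms(1,2)])
    (simp_all add: proj_le_iff_ker[OF assms(1,2)] proj_le_iff_ker[OF assms(2,1)] assms(3))

text \<open>The commutant is selfadjoint, so it leaves the orthogonal complement of \<open>M\<close>
  invariant too; the projection therefore commutes with it and lies in the bicommutant.\<close>

lemma exists_Proj_onto:
  assumes M: "subspace M" "closed M"
    and inv: "\<And>Y m. Y \<in> commutant A \<Longrightarrow> m \<in> M \<Longrightarrow> Y m \<in> M"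
  shows "\<exists>P\<in>Proj A. range P = M"
proof -
  obtain P :: "'a \<Rightarrow>\<^sub>L 'a" where P: "range P = M" "\<And>m. m \<in> M \<Longrightarrow> P m = m"
     "\<And>x m. m \<in> M \<Longrightarrow> (x - P x) \<bullet> m = 0"
    using closed_subspace_projection[OF M] by blast
  have PM: "P x \<in> M" for x using P(1) by blast
  have sa: "P x \<bullet> y = x \<bullet> P y" for x y
    using P(3)[OF PM, of x y] P(3)[OF PM, of y x] by (simp add: inner_simps inner_commute)
  have zero: "P x = 0" if "\<And>m. m \<in> M \<Longrightarrow> x \<bullet> m = 0" for x
    using that[OF PM, of x] sa[of x "P x"] by (simp add: P(2) PM)
  have "P (Y x) = Y (P x)"
    if Y: "Y \<in> commutant A" for Y x
  proof -
    have Yb: "Y \<in> bounded_ops" using Y by (simp add: commutant_def)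
    have "P (Y (x - P x)) = 0"
    proof (rule zero)
      fix m assume m: "m \<in> M"
      have "Y (x - P x) \<bullet> m = (x - P x) \<bullet> adj Y m"
        by (rule inner_adj(1)[OF Yb])
      also have "\<dots> = 0" using P(3) inv commutant_adj Y m by blast
      finally show "Y (x - P x) \<bullet> m = 0" .
    qed
    then show ?thesis using P(2)[OF inv[OF Y PM]] by (simp add: blinfun.bilinear_simps)
  qed
  then have "P \<in> A" by (simp add: mem_iff_commutes)
  then have "P \<in> Proj A" by (rule Proj_I) (simp_all add: P(2) PM sa)
  then show ?thesis using P(1) by blast
qed


section \<open>Polar decomposition\<close>

text \<open>With \<open>a = 1 - X\<^sup>*X / c\<^sup>2\<close> of norm at most 1, the iteration \<open>y \<mapsto> (a + y\<^sup>2) / 2\<close> converges to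
  some \<open>y\<close> with \<open>(1 - y)\<^sup>2 = X\<^sup>*X / c\<^sup>2\<close>; its increments are dominated by those of the scalar
  iteration \<open>r \<mapsto> (1 + r\<^sup>2) / 2\<close>, which increases to 1.\<close>

lemma exists_selfadjoint_root:
  assumes X: "X \<in> A"
  shows "\<exists>S\<in>A. adj S = S \<and> S o\<^sub>L S = adj X o\<^sub>L X"
proof -
  \<comment> \<open>The added 1 keeps \<open>c\<close> positive when \<open>X = 0\<close>.\<close>
  define c where "c = norm X + 1"
  have c: "c > 0" by (simp add: c_def add_nonneg_pos)
  define W where "W = (1 / c) *\<^sub>R X"
  have W: "W \<in> A" using X by (simp add: W_def)
  have nW: "norm W \<le> 1" using c by (simp add: W_def c_def field_simps)
  define a where "a = id_blinfun - (adj W o\<^sub>L W)"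
  have aA: "a \<in> A" and aadj: "adj a = a" using W by (simp_all add: a_def adj_simps)
  \<comment> \<open>Expanding the square, \<open>norm (adj W (W z)) \<le> norm (W z)\<close> absorbs
    the quadratic term into half of the cross term.\<close>
  have na: "norm a \<le> 1"
  proof (rule norm_blinfun_bound)
    fix z
    let ?w = "adj W (W z)"
    have "norm ?w \<le> norm (W z)"
      using order_trans[OF norm_blinfun[of "adj W" "W z"]
          mult_right_mono[of "norm (adj W)" 1]] nW norm_adj[of W] W by simp
    then have "(norm ?w)\<^sup>2 \<le> (norm (W z))\<^sup>2" by (simp add: power_mono)
    moreover have "z \<bullet> ?w = (norm (W z))\<^sup>2"
      using inner_adj(1)[of W z "W z"] W by (simp add: power2_norm_eq_inner)
    moreover have "(norm (z - ?w))\<^sup>2 = (norm z)\<^sup>2 - 2 * (z \<bullet> ?w) + (norm ?w)\<^sup>2"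
      by (simp add: power2_norm_eq_inner inner_simps inner_commute)
    ultimately have "(norm (z - ?w))\<^sup>2 \<le> (norm z)\<^sup>2" 
      using zero_le_power2[of "norm (W z)"] by linarith
    then have "norm (z - ?w) \<le> norm z" by (rule power2_le_imp_le) simp
    then show "norm (blinfun_apply a z) \<le> 1 * norm z"
      by (simp add: a_def blinfun.bilinear_simps)
  qed simp
  define y :: "nat \<Rightarrow> 'a \<Rightarrow>\<^sub>L 'a" where "y = rec_nat 0 (\<lambda>_ y. (1/2) *\<^sub>R (a + (y o\<^sub>L y)))"
  have y0: "y 0 = 0" and ySuc: "y (Suc n) = (1/2) *\<^sub>R (a + (y n o\<^sub>L y n))" for n
    by (simp_all add: y_def)
  define r :: "nat \<Rightarrow> real" where "r = rec_nat 0 (\<lambda>_ r. (1 + r\<^sup>2) / 2)"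
  have r0: "r 0 = 0" and rSuc: "r (Suc n) = (1 + (r n)\<^sup>2) / 2" for n
    by (simp_all add: r_def)
  have r1: "0 \<le> r n \<and> r n \<le> 1" for n
    by (induction n) (auto simp: r0 rSuc power_le_one)
  have rmono: "r n \<le> r (Suc n)" for n
  proof -
    have "0 \<le> (r n - 1)\<^sup>2" by simp
    then show ?thesis by (simp add: rSuc power2_eq_square algebra_simps)
  qed
  have yA: "y n \<in> A \<and> adj (y n) = y n" for n
    by (induction n) (auto simp: y0 ySuc aA aadj adj_simps)
  have ny: "norm (y n) \<le> r n" for n
  proof (induction n)
    case (Suc n)
    have "norm (y n o\<^sub>L y n) \<le> r n * r n"
      using norm_blinfun_compose[of "y n" "y n"] mult_mono[OF Suc Suc] r1[of n] by simp
    then have "norm (a + (y n o\<^sub>L y n)) \<le> 1 + (r n)\<^sup>2"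
      using na norm_triangle_ineq[of a "y n o\<^sub>L y n"] by (simp add: power2_eq_square)
    then show ?case by (simp add: ySuc rSuc)
  qed (simp add: y0 r0)
  have dy: "norm (y (Suc n) - y n) \<le> r (Suc n) - r n" for n
  proof (induction n)
    case 0
    show ?case using na by (simp add: y0 ySuc r0 rSuc)
  next
    case (Suc n)
    let ?d = "y (Suc n) - y n"
    \<comment> \<open>The difference of squares is split as \<open>u (u - v) + (u - v) v\<close>,
      which holds for noncommuting \<open>u\<close>, \<open>v\<close>; the bounds then reproduce the
      scalar recursion for \<open>r\<close>.\<close>
    have "y (Suc (Suc n)) - y (Suc n) = (1/2) *\<^sub>R ((y (Suc n) o\<^sub>L ?d) + (?d o\<^sub>L y n))"
      unfolding ySuc[of "Suc n"] ySuc[of n]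
      by (rule blinfun_eqI) (simp add: blinfun.bilinear_simps algebra_simps)
    then have "norm (y (Suc (Suc n)) - y (Suc n)) \<le> (norm (y (Suc n) o\<^sub>L ?d) + norm (?d o\<^sub>L y n)) / 2"
      using norm_triangle_ineq[of "y (Suc n) o\<^sub>L ?d" "?d o\<^sub>L y n"] by simp
    also have "\<dots> \<le> (r (Suc n) * (r (Suc n) - r n) + (r (Suc n) - r n) * r n) / 2"
      using order_trans[OF norm_blinfun_compose[of "y (Suc n)" ?d] mult_mono[OF ny Suc]]
        order_trans[OF norm_blinfun_compose[of ?d "y n"] mult_mono[OF Suc ny]] r1[of n] r1[of "Suc n"] rmono[of n]
      by (simp del: minus_diff_eq)
    also have "\<dots> = r (Suc (Suc n)) - r (Suc n)"
      by (simp add: rSuc[of "Suc n"]) (simp add: rSuc power2_eq_square field_simps)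
    finally show ?case .
  qed
  have dyr: "norm (y (n + k) - y n) \<le> r (n + k) - r n" for n k
  proof (induction k)
    case (Suc k)
    then show ?case using dy[of "n + k"] norm_triangle_ineq[of "y (Suc (n + k)) - y (n + k)" "y (n + k) - y n"]
      by simp
  qed simp
  have "incseq r" using rmono by (rule incseq_SucI)
  then have "convergent r" using r1
    by (intro Bseq_monoseq_convergent BseqI'[of _ 1] incseq_imp_monoseq) auto
  then have "Cauchy r" by (rule convergent_Cauchy)
  have "Cauchy y"
    unfolding Cauchy_altdef2
  proof (intro allI impI)
    fix e :: real assume "e > 0"
    then obtain N where N: "\<forall>n\<ge>N. dist (r n) (r N) < e" using \<open>Cauchy r\<close> by (auto simp: Cauchy_altdef2)
    have "dist (y n) (y N) < e" if "n \<ge> N" for n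
    proof -
      obtain k where "n = N + k" using \<open>n \<ge> N\<close> le_Suc_ex by blast
      then have "norm (y n - y N) \<le> \<bar>r n - r N\<bar>" using dyr[of N k] by simp
      then show ?thesis using N that by (auto simp: dist_norm)
    qed
    then show "\<exists>N. \<forall>n\<ge>N. dist (y n) (y N) < e" by blast
  qed
  then obtain L where L: "y \<longlonglongrightarrow> L" by (auto simp: Cauchy_convergent_iff convergent_def)
  have LA: "L \<in> A" using closed_sequentially[OF closed_algebra] yA L by blast
  have "(\<lambda>n. y (Suc n)) \<longlonglongrightarrow> (1/2) *\<^sub>R (a + (L o\<^sub>L L))"
    unfolding ySuc by (intro tendsto_intros L)
  then have Leq: "L = (1/2) *\<^sub>R (a + (L o\<^sub>L L))"
    using LIMSEQ_Suc[OF L] LIMSEQ_unique by blast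
  have Lsa: "L x \<bullet> z = x \<bullet> L z" for x z
  proof (rule LIMSEQ_unique)
    show "(\<lambda>n. (y n) x \<bullet> z) \<longlonglongrightarrow> L x \<bullet> z" by (intro tendsto_intros L)
    have "(\<lambda>n. (y n) x \<bullet> z) = (\<lambda>n. x \<bullet> (y n) z)"
      using inner_adj(1)[of "y _"] yA by auto
    then show "(\<lambda>n. (y n) x \<bullet> z) \<longlonglongrightarrow> x \<bullet> L z"
      by simp (intro tendsto_intros L)
  qed
  have Ladj: "adj L = L" using LA Lsa by (intro adj_unique) auto
  \<comment> \<open>The limit satisfies \<open>2 L = a + L L\<close>, so the square of
    \<open>1 - L\<close> is \<open>1 - a\<close>, and the factor \<open>c\<close> undoes the
    normalisation.\<close>
  define S where "S = c *\<^sub>R (id_blinfun - L)"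
  have SA: "S \<in> A" "adj S = S" using LA Ladj by (simp_all add: S_def adj_simps)
  have "S (S z) = adj X (X z)" for z
  proof -
    have "2 *\<^sub>R L z = blinfun_apply a z + L (L z)"
      by (subst Leq) (simp add: blinfun.bilinear_simps)
    moreover have "blinfun_apply a z = z - (1 / c\<^sup>2) *\<^sub>R adj X (X z)"
      using X by (simp add: a_def W_def adj_simps blinfun.bilinear_simps power2_eq_square)
    ultimately have "z - 2 *\<^sub>R L z + L (L z)
        = (1 / c\<^sup>2) *\<^sub>R adj X (X z)"
      by (simp add: algebra_simps)
    moreover have "S (S z)
        = c\<^sup>2 *\<^sub>R (z - 2 *\<^sub>R L z + L (L z))"
      by (simp add: S_def blinfun.bilinear_simps algebra_simps power2_eq_square scaleR_2)
    ultimately show ?thesis using c by simp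
  qed
  then have "S o\<^sub>L S = adj X o\<^sub>L X" by (intro blinfun_eqI) simp
  then show ?thesis using SA by blast
qed

lemma subspace_closure:
  fixes M :: "'b::real_normed_vector set"
  assumes M: "subspace M"
  shows "subspace (closure M)"
  unfolding subspace_def
proof (intro conjI ballI allI)
  show "0 \<in> closure M" using subspace_0[OF M] closure_subset by blast
next
  fix x y assume "x \<in> closure M" "y \<in> closure M"
  then obtain f g where "\<And>n::nat. f n \<in> M" "f \<longlonglongrightarrow> x" "\<And>n::nat. g n \<in> M" "g \<longlonglongrightarrow> y"
    unfolding closure_sequential by blast
  then show "x + y \<in> closure M"
    unfolding closure_sequential using subspace_add[OF M]
    by (intro exI[of _ "\<lambda>n. f n + g n"]) (auto intro: tendsto_intros)
next
  fix c x assume "x \<in> closure M"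
  then obtain f where "\<And>n::nat. f n \<in> M" "f \<longlonglongrightarrow> x" unfolding closure_sequential by blast
  then show "c *\<^sub>R x \<in> closure M"
    unfolding closure_sequential using subspace_scale[OF M]
    by (intro exI[of _ "\<lambda>n. c *\<^sub>R f n"]) (auto intro: tendsto_intros)
qed

text \<open>The partial isometry is read off the closure of the graph \<open>{(S z, X z)}\<close>, where
  \<open>S\<^sup>2 = X\<^sup>*X\<close>.\<close>

lemma polar_decomposition:
  assumes X: "X \<in> A"
  obtains V where "V \<in> A" "adj V o\<^sub>L V \<in> Proj A" "V o\<^sub>L adj V \<in> Proj A"
    "range ((V o\<^sub>L adj V)) = closure (range X)"
    "\<And>z. (adj V o\<^sub>L V) z = 0 \<longleftrightarrow> X z = 0"
proof -
  obtain S where S: "S \<in> A" "adj S = S" "S o\<^sub>L S = adj X o\<^sub>L X"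
    using exists_selfadjoint_root[OF X] by blast
  have Ssa: "S x \<bullet> y = x \<bullet> S y" for x y
    using inner_adj(1)[of S x y] S by simp
  have SS: "S (S z) = adj X (X z)" for z
    using S(3) by (metis blinfun_apply_blinfun_compose)
  have nSX: "norm (S z) = norm (X z)" for z
    using inner_adj(1)[of X z "X z"] X Ssa[of z "S z"]
    by (simp add: norm_eq_sqrt_inner SS)
  define G where "G = range (\<lambda>z. (S z, X z))"
  define C where "C = closure G"
  have "linear (\<lambda>z. (S z, X z))"
    by (auto intro!: linearI simp: blinfun.bilinear_simps)
  then have "subspace G" unfolding G_def by (rule linear_subspace_image) simp
  then have C: "subspace C" unfolding C_def by (rule subspace_closure)
  \<comment> \<open>A closed condition on pairs has to be checked only on the graph
    \<open>G\<close>.\<close>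
  have ind: "p \<in> C \<Longrightarrow> closed {p. Q p} \<Longrightarrow> (\<And>z. Q (S z, X z)) \<Longrightarrow> Q p" for p Q
    unfolding C_def using closure_minimal[of G "{p. Q p}"] by (auto simp: G_def)
  have nC: "norm (fst p) = norm (snd p)" if "p \<in> C" for p
    by (rule ind[OF that]) (auto intro!: closed_Collect_eq continuous_intros simp: nSX)
  \<comment> \<open>The difference of the two pairs has first component 0, hence second component 0:
    the closure is still the graph of a map.\<close>
  have uniq: "v = v'" if "(w, v) \<in> C" "(w, v') \<in> C" for w v v'
    using nC[OF subspace_diff[OF C that]] by simp
  define M where "M = fst ` C"
  have M: "subspace M" unfolding M_def
    by (rule linear_subspace_image[OF _ C]) (simp add: bounded_linear.linear bounded_linear_fst)
  have "complete M" unfolding M_def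
  proof (rule complete_isometric_image[of "1/2"])
    \<comment> \<open>Both components have the same norm, so a pair has at most twice the norm of
      its first component.\<close>
    show "\<forall>x\<in>C. 1 / 2 * norm x \<le> norm (fst x)"
    proof
      fix x assume "x \<in> C"
      then show "1 / 2 * norm x \<le> norm (fst x)"
        using nC[of x] norm_Pair_le[of "fst x" "snd x"] by simp
    qed
    show "complete C" by (simp add: C_def complete_eq_closed)
  qed (simp_all add: C bounded_linear_fst)
  then have Mcl: "closed M" by (simp add: complete_eq_closed)
  have inv: "(Y w, Y v) \<in> C" if Y: "Y \<in> commutant A" and "(w, v) \<in> C" for Y w v
  proof -
    have "(Y (fst (w, v)), Y (snd (w, v))) \<in> C"
    proof (rule ind[OF that(2)])
      show "closed {p. (Y (fst p), Y (snd p)) \<in> C}"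
        using closed_vimage[of C "\<lambda>p. (Y (fst p), Y (snd p))"]
        by (simp add: C_def vimage_def continuous_intros)
      show "(Y (fst (S z, X z)),
             Y (snd (S z, X z))) \<in> C" for z
        using Y X S(1) closure_subset[of G] unfolding C_def G_def fst_conv snd_conv
        by (metis (no_types, lifting) mem_iff_commutes rangeI subset_iff)
    qed
    then show ?thesis by simp
  qed
  have "Y m \<in> M" if "Y \<in> commutant A" "m \<in> M" for Y m
    using that inv unfolding M_def by force
  then obtain P where P: "P \<in> Proj A" "range P = M"
    using exists_Proj_onto[OF M Mcl] by blast
  note PD = Proj_D[OF P(1)]
  \<comment> \<open>\<open>V\<close> sends \<open>x\<close> to the partner of \<open>P x\<close> in
    \<open>C\<close>: isometric on \<open>M\<close>, zero on its complement.\<close>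
  have "\<exists>v. (P x, v) \<in> C" for x
    using P(2) unfolding M_def by (metis (no_types, lifting) imageE prod.collapse rangeI)
  then obtain v where v: "\<And>x. (P x, v x) \<in> C" by metis
  have nv: "norm (v x) = norm (P x)" for x using nC[OF v[of x]] by simp
  have "bounded_linear v"
  proof (rule bounded_linear_intro[where K = "norm P"])
    show "v (x + y) = v x + v y" for x y
      using v[of "x + y"] subspace_add[OF C v[of x] v[of y]] uniq by (simp add: blinfun.add_right)
    show "v (r *\<^sub>R x) = r *\<^sub>R v x" for r x
      using v[of "r *\<^sub>R x"] subspace_scale[OF C v[of x], of r] uniq by (simp add: blinfun.scaleR_right)
    show "norm (v x) \<le> norm x * norm P" for x
      using norm_blinfun[of P x] by (simp add: nv mult.commute)
  qed
  then obtain V :: "'a \<Rightarrow>\<^sub>L 'a" where V: "\<And>x. V x = v x"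
    by (metis bounded_linear_Blinfun_apply)
  have VA: "V \<in> A"
    unfolding mem_iff_commutes
  proof (intro ballI allI)
    fix Y x assume Y: "Y \<in> commutant A"
    have "(P (Y x), Y (v x)) \<in> C"
      using inv[OF Y v[of x]] PD(1) Y by (simp add: mem_iff_commutes)
    then show "V (Y x) = Y (V x)"
      using v[of "Y x"] uniq by (simp add: V)
  qed
  \<comment> \<open>Polarisation of \<open>norm (V x) = norm (P x)\<close>.\<close>
  have E: "adj V o\<^sub>L V = P"
  proof (rule blinfun_eqI, rule vector_eq_ldot[THEN iffD1], intro allI)
    fix x y
    have "y \<bullet> (adj V o\<^sub>L V) x = V y \<bullet> V x"
      using inner_adj(1)[of V y] VA by simp
    also have "\<dots> = P y \<bullet> P x"
      unfolding dot_norm blinfun.add_right[symmetric] by (simp add: V nv)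
    also have "\<dots> = y \<bullet> P x" by (simp add: PD)
    finally show "y \<bullet> (adj V o\<^sub>L V) x = y \<bullet> P x" .
  qed
  have Ex: "adj V (V x) = P x" for x
    using E by (metis blinfun_apply_blinfun_compose)
  have VP: "V (P x) = V x" for x
    using v[of "P x"] v[of x] uniq by (simp add: V PD(2))
  have F: "V o\<^sub>L adj V \<in> Proj A"
    using VA by (intro Proj_I) (simp_all add: Ex VP inner_adj(1) adj_simps(3))
  have VS: "V (S z) = X z" for z
  proof -
    have SXC: "(S z, X z) \<in> C"
      using closure_subset[of G] by (auto simp: C_def G_def)
    then have "S z \<in> M" by (force simp: M_def)
    then have "P (S z) = S z" using P(2) PD(5) by blast
    then show ?thesis using v[of "S z"] SXC uniq by (simp add: V)
  qed
  have "range ((V o\<^sub>L adj V)) = closure (range X)"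
  proof
    have "snd p \<in> closure (range X)" if "p \<in> C" for p
    proof (rule ind[OF that])
      show "closed {p :: 'a \<times> 'a. snd p \<in> closure (range X)}"
        using closed_vimage[of "closure (range X)" "snd :: 'a \<times> 'a \<Rightarrow> 'a"]
        by (simp add: vimage_def continuous_intros)
      show "snd (S z, X z) \<in> closure (range X)" for z
        using closure_subset[of "range X"] by auto
    qed
    from this[OF v] have "v x \<in> closure (range X)" for x by simp
    then show "range ((V o\<^sub>L adj V)) \<subseteq> closure (range X)"
      by (auto simp: V)
    have "X z \<in> range ((V o\<^sub>L adj V))" for z
      unfolding Proj_D(5)[OF F] by (simp add: VS[symmetric] Ex VP)
    then show "closure (range X) \<subseteq> range ((V o\<^sub>L adj V))"
      by (intro closure_minimal closed_range_Proj F) auto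
  qed
  \<comment> \<open>\<open>M\<close> contains the range of \<open>S\<close> and is approximated by
    it, so orthogonality to \<open>M\<close> means \<open>S z = 0\<close> by selfadjointness, and
    \<open>S\<close> and \<open>X\<close> have the same kernel.\<close>
  moreover have "P z = 0 \<longleftrightarrow> X z = 0" for z
  proof
    assume 0: "P z = 0"
    have "(S (S z), X (S z)) \<in> C"
      using closure_subset[of G] by (auto simp: C_def G_def)
    then have "S (S z) \<in> M" by (force simp: M_def)
    then have "P (S (S z)) = S (S z)"
      using P(2) PD(5) by blast
    then have "z \<bullet> S (S z) = 0" using PD(3)[of z] 0 by (metis inner_zero_left)
    then have "S z = 0" using Ssa[of z "S z"] by simp
    then show "X z = 0" using nSX[of z] by simp
  next
    assume "X z = 0"
    then have "S z = 0" using nSX[of z] by simp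
    then have zS: "z \<bullet> S x = 0" for x using Ssa[of z x] by simp
    have "z \<bullet> fst p = 0" if "p \<in> C" for p
      by (rule ind[OF that]) (auto intro!: closed_Collect_eq continuous_intros simp: zS)
    from this[OF v] have "P z \<bullet> P z = 0" by (simp add: PD)
    then show "P z = 0" by simp
  qed
  ultimately show ?thesis using that[of V] VA E F P(1) by simp
qed


section \<open>Finite projections and the finite ideal\<close>

text \<open>Since \<open>norm (adj V u)\<close> squared equals \<open>u \<bullet> P u\<close>,
  \<open>adj V\<close> vanishes on the kernel of \<open>P\<close>; the remaining identity is the
  adjoint of this.\<close>

lemma partial_isometry:
  assumes V: "V \<in> A" and P: "V o\<^sub>L adj V = P" "P \<in> Proj A"
  shows "V (adj V x) = P x"
    "P (V x) = V x"
    "adj V (P x) = adj V x"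
proof -
  show VV: "V (adj V x) = P x" for x
    using P(1) by (metis blinfun_apply_blinfun_compose)
  note PD = Proj_D[OF P(2)]
  show *: "adj V (P x) = adj V x" for x
  proof -
    let ?u = "x - P x"
    have "adj V ?u \<bullet> adj V ?u = ?u \<bullet> P ?u"
      using V by (simp add: inner_adj(2) VV)
    also have "\<dots> = 0" by (simp add: blinfun.bilinear_simps PD(2))
    finally show ?thesis by (simp add: blinfun.bilinear_simps)
  qed
  show "P (V x) = V x"
    using V by (intro vector_eq_ldot[THEN iffD1])
      (simp add: PD(3)[symmetric] inner_adj(2)[symmetric] *)
qed

lemma partial_isometry_simps:
  assumes V: "V \<in> A" "V o\<^sub>L adj V = P" "adj V o\<^sub>L V = Q" and PQ: "P \<in> Proj A" "Q \<in> Proj A"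
  shows "V (adj V x) = P x"
    "adj V (V x) = Q x"
    "P (V x) = V x"
    "V (Q x) = V x"
    "Q (adj V x) = adj V x"
    "adj V (P x) = adj V x"
  using partial_isometry[OF V(1,2) PQ(1)] partial_isometry[of "adj V" Q] V PQ(2)
  by (simp_all add: adj_simps)

lemma mvn_equiv_sym: "mvn_equiv A P Q \<Longrightarrow> mvn_equiv A Q P"
  unfolding mvn_equiv_def by (metis adj_simps(3) bounded_op mem_closed(7))

text \<open>Conjugation by \<open>V\<close> carries an equivalence of \<open>P\<close> with a proper
  subprojection \<open>P'\<close> to one of \<open>Q\<close> with \<open>Q'\<close>.\<close>

lemma Proj0_equiv:
  assumes P: "P \<in> Proj A" and Q: "Q \<in> Proj0 A" and PQ: "mvn_equiv A P Q"
  shows "P \<in> Proj0 A"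
proof (rule ccontr)
  assume "P \<notin> Proj0 A"
  then obtain P' where P': "P' \<in> Proj A" "proj_le P' P" "P' \<noteq> P" "mvn_equiv A P P'"
    using P by (auto simp: Proj0_def)
  have QP: "Q \<in> Proj A" using Q by (simp add: Proj0_def)
  obtain V where V: "V \<in> A" "V o\<^sub>L adj V = P" "adj V o\<^sub>L V = Q"
    using PQ by (auto simp: mvn_equiv_def)
  note V = V partial_isometry_simps[OF V P QP]
  obtain W where W: "W \<in> A" "W o\<^sub>L adj W = P" "adj W o\<^sub>L W = P'"
    using P'(4) by (auto simp: mvn_equiv_def)
  note W = W partial_isometry_simps[OF W P P'(1)]
  note le = proj_le_D[OF P'(1) P P'(2)]
  have PW: "P (adj W x) = adj W x" for x
    by (metis W(8) le(1))
  define Q' where "Q' = adj V o\<^sub>L P' o\<^sub>L V"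
  define Z where "Z = adj V o\<^sub>L W o\<^sub>L V"
  have Z: "Z \<in> A" "adj Z = adj V o\<^sub>L adj W o\<^sub>L V"
    using V(1) W(1) by (simp_all add: Z_def adj_simps) (simp add: blinfun_eq_pointwise)
  have Q': "Q' \<in> Proj A"
    using V(1) P'(1) Proj_D[OF P'(1)] unfolding Q'_def
    by (intro Proj_I) (simp_all add: V le inner_adj(1) adj_simps(3))
  have "Z o\<^sub>L adj Z = Q"
    unfolding Z(2) unfolding Z_def by (rule blinfun_eqI) (simp add: V W PW)
  moreover have "adj Z o\<^sub>L Z = Q'"
    unfolding Z(2) unfolding Z_def Q'_def by (rule blinfun_eqI) (simp add: V W)
  ultimately have "mvn_equiv A Q Q'" using Z(1) by (auto simp: mvn_equiv_def)
  moreover have "proj_le Q' Q"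
    unfolding proj_le_def Proj_D(5)[OF QP] subset_iff by (auto simp: Q'_def V Proj_D(2)[OF QP])
  moreover have "Q' \<noteq> Q"
  proof
    assume "Q' = Q"
    \<comment> \<open>Conjugating back would give \<open>P' = P\<close>.\<close>
    then have "V (Q' (adj V x)) = P x" for x
      by (simp add: V)
    then have "P' x = P x" for x
      by (simp add: Q'_def V le)
    then show False using P'(3) blinfun_eqI by blast
  qed
  ultimately show False using Q Q' by (auto simp: Proj0_def)
qed

text \<open>An equivalence of \<open>R\<close> with a proper subprojection extends by the identity
  on \<open>P - R\<close> to one of \<open>P\<close> with a proper subprojection.\<close>

lemma Proj0_sub:
  assumes P: "P \<in> Proj0 A" and R: "R \<in> Proj A" "proj_le R P"
  shows "R \<in> Proj0 A"
proof (rule ccontr)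
  assume "R \<notin> Proj0 A"
  then obtain R' where R': "R' \<in> Proj A" "proj_le R' R" "R' \<noteq> R" "mvn_equiv A R R'"
    using R by (auto simp: Proj0_def)
  have PP: "P \<in> Proj A" using P by (simp add: Proj0_def)
  obtain W where W: "W \<in> A" "W o\<^sub>L adj W = R" "adj W o\<^sub>L W = R'"
    using R'(4) by (auto simp: mvn_equiv_def)
  note W = W partial_isometry_simps[OF W R(1) R'(1)]
  note le = proj_le_D[OF R(1) PP R(2)] and le' = proj_le_D[OF R'(1) R(1) R'(2)]
  note PD = Proj_D[OF PP] and RD = Proj_D[OF R(1)] and R'D = Proj_D[OF R'(1)]
  have PR': "P (R' x) = R' x" for x by (metis le(1) le'(1))
  have R'P: "R' (P x) = R' x" for x by (metis le(2) le'(2))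
  have 1: "W (P x) = W x"
    "W (R x) = W x"
    "P (W x) = W x"
    "P (adj W x) = adj W x"
    "R (adj W x) = adj W x"
    "adj W (P x) = adj W x" for x
    using R'P le' PR' le W(6-9) by metis+
  define P' where "P' = R' + (P - R)"
  define Z where "Z = W + (P - R)"
  have Z: "Z \<in> A" "adj Z = adj W + (P - R)"
    using W(1) PD RD by (simp_all add: Z_def adj_simps)
  have P': "P' \<in> Proj A"
    unfolding P'_def using PD RD R'D
    by (intro Proj_I) (simp_all add: blinfun.bilinear_simps le le' PR' R'P inner_simps)
  have "Z o\<^sub>L adj Z = P"
    unfolding Z(2) unfolding Z_def
    by (rule blinfun_eqI) (simp add: blinfun.bilinear_simps W 1 le PD RD)
  moreover have "adj Z o\<^sub>L Z = P'"
    unfolding Z(2) unfolding Z_def P'_def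
    by (rule blinfun_eqI) (simp add: blinfun.bilinear_simps W 1 le PD RD)
  ultimately have "mvn_equiv A P P'" using Z(1) by (auto simp: mvn_equiv_def)
  moreover have "proj_le P' P"
    unfolding proj_le_def Proj_D(5)[OF PP] subset_iff
    by (auto simp: P'_def blinfun.bilinear_simps le PR' PD)
  moreover have "P' \<noteq> P" using R'(3) by (auto simp: P'_def)
  ultimately show False using P P' by (auto simp: Proj0_def)
qed

text \<open>The kernel condition puts the initial projection of \<open>X\<close> below
  \<open>P\<close>; the range projection is equivalent to it.\<close>

lemma range_support_finite:
  assumes X: "X \<in> A" and P: "P \<in> Proj0 A" and XP: "\<And>x. P x = 0 \<Longrightarrow> X x = 0"
  shows "\<exists>Q\<in>Proj0 A. range Q = closure (range X)"
proof -
  have PP: "P \<in> Proj A" using P by (simp add: Proj0_def)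
  obtain V where V: "V \<in> A" "adj V o\<^sub>L V \<in> Proj A" "V o\<^sub>L adj V \<in> Proj A"
    "range ((V o\<^sub>L adj V)) = closure (range X)"
    "\<And>z. (adj V o\<^sub>L V) z = 0 \<longleftrightarrow> X z = 0"
    by (rule polar_decomposition[OF X]) (rule that)
  have "proj_le (adj V o\<^sub>L V) P" unfolding proj_le_iff_ker[OF V(2) PP] using V(5) XP by blast
  then have "adj V o\<^sub>L V \<in> Proj0 A" using Proj0_sub[OF P V(2)] by blast
  moreover have "mvn_equiv A (V o\<^sub>L adj V) (adj V o\<^sub>L V)" using V(1) by (auto simp: mvn_equiv_def)
  ultimately have "V o\<^sub>L adj V \<in> Proj0 A" using Proj0_equiv[OF V(3)] by blast
  then show ?thesis using V(4) by blast
qed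

lemma initial_support_finite:
  assumes X: "X \<in> A" and Q: "Q \<in> Proj0 A" "range Q = closure (range X)"
  shows "\<exists>P\<in>Proj0 A. \<forall>x. P x = 0 \<longleftrightarrow> X x = 0"
proof -
  have QP: "Q \<in> Proj A" using Q by (simp add: Proj0_def)
  obtain V where V: "V \<in> A" "adj V o\<^sub>L V \<in> Proj A" "V o\<^sub>L adj V \<in> Proj A"
    "range ((V o\<^sub>L adj V)) = closure (range X)"
    "\<And>z. (adj V o\<^sub>L V) z = 0 \<longleftrightarrow> X z = 0"
    by (rule polar_decomposition[OF X]) (rule that)
  have "V o\<^sub>L adj V = Q" using proj_le_antisym[OF V(3) QP] V(4) Q(2) by (simp add: proj_le_def)
  then have "mvn_equiv A Q (adj V o\<^sub>L V)" using V(1) by (auto simp: mvn_equiv_def)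
  then have "adj V o\<^sub>L V \<in> Proj0 A" using Proj0_equiv[OF V(2) Q(1)] mvn_equiv_sym by blast
  then show ?thesis using V(5) by blast
qed

section \<open>The ideal generated by the finite projections\<close>

lemma fin_idealI:
  assumes "X \<in> A" "P \<in> Proj0 A" "\<And>x. P x = 0 \<Longrightarrow> X x = 0"
  shows "X \<in> fin_ideal A"
  unfolding fin_ideal_def
  using range_support_finite[OF assms] assms(1) by (intro subsetD[OF closure_subset]) simp

lemma fin_ideal_approx:
  assumes "F \<in> fin_ideal A" "e > 0"
  obtains F0 Q where "F0 \<in> A" "Q \<in> Proj0 A"
    "range Q = closure (range F0)" "norm (F - F0) < e"
proof -
  obtain F0 where "F0 \<in> {S \<in> A. \<exists>P\<in>Proj0 A. range P = closure (range S)}"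
    "dist F0 F < e"
    using assms unfolding fin_ideal_def closure_approachable by blast
  then show ?thesis using that by (auto simp: dist_norm norm_minus_commute)
qed

lemma fin_ideal_subset: "F \<in> fin_ideal A \<Longrightarrow> F \<in> A"
proof -
  have "fin_ideal A \<subseteq> A" unfolding fin_ideal_def by (rule closure_minimal[OF _ closed_algebra]) auto
  then show "F \<in> fin_ideal A \<Longrightarrow> F \<in> A" by blast
qed

text \<open>If \<open>F0\<close> approximates \<open>F\<close> and has finite range projection
  \<open>Q\<close>, then \<open>adj F0\<close> vanishes on the kernel of \<open>Q\<close>, so its
  range projection is finite as well, and the adjoint preserves the distance.\<close>

lemma fin_ideal_adj:
  assumes F: "F \<in> fin_ideal A"
  shows "adj F \<in> fin_ideal A"
  unfolding fin_ideal_def closure_approachable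
proof (intro allI impI)
  fix e :: real assume "e > 0"
  obtain F0 Q where F0: "F0 \<in> A" "Q \<in> Proj0 A"
    "range Q = closure (range F0)" "norm (F - F0) < e"
    by (rule fin_ideal_approx[OF F \<open>e > 0\<close>]) (rule that)
  have "adj F0 x = 0" if "Q x = 0" for x
  proof (rule vector_eq_ldot[THEN iffD1], intro allI)
    fix y
    have QP: "Q \<in> Proj A" using F0(2) by (simp add: Proj0_def)
    have "F0 y \<in> range Q"
      unfolding F0(3) by (rule subsetD[OF closure_subset]) simp
    then have "Q (F0 y) = F0 y" unfolding Proj_D(5)[OF QP] .
    then show "y \<bullet> adj F0 x = y \<bullet> 0"
      using F0(1) that Proj_D(3)[OF QP, of "F0 y" x] by (simp add: inner_adj(1)[symmetric])
  qed
  then obtain P where "P \<in> Proj0 A" "range P = closure (range ((adj F0)))"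
    using range_support_finite[of "adj F0" Q] F0 by auto
  moreover have "dist (adj F0) (adj F) < e"
    using norm_adj[of "F - F0"] F0(1,4) fin_ideal_subset[OF F]
    by (simp add: adj_simps dist_norm bounded_ops_closed norm_minus_commute)
  ultimately show "\<exists>y\<in>{S \<in> A. \<exists>P\<in>Proj0 A. range P = closure (range S)}. dist y (adj F) < e"
    using F0(1) by (intro bexI[of _ "adj F0"]) auto
qed


section \<open>Operators bounded below\<close>

lemma left_inverse_imp_bounded_below:
  fixes L S :: "'a \<Rightarrow>\<^sub>L 'a"
  assumes "\<And>x. L (S x) = x"
  shows "bounded_below S"
  unfolding bounded_below_def
\<comment> \<open>The added 1 avoids division by zero when \<open>L = 0\<close>.\<close>
proof (intro exI[of _ "1 / (norm L + 1)"] conjI allI)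
  have pos: "0 < norm L + 1" by (simp add: add_nonneg_pos)
  then show "0 < 1 / (norm L + 1)" by simp
  fix x
  have "norm x \<le> norm L * norm (S x)" using norm_blinfun[of L "S x"] assms by simp
  also have "\<dots> \<le> (norm L + 1) * norm (S x)" by (simp add: mult_right_mono)
  finally show "1 / (norm L + 1) * norm x \<le> norm (S x)" using pos by (simp add: field_simps)
qed

text \<open>A perturbation smaller than half the lower bound leaves the other half.\<close>

lemma bounded_below_perturb:
  fixes S :: "'a \<Rightarrow>\<^sub>L 'a"
  assumes "bounded_below S"
  shows "\<exists>e>0. \<forall>R. norm (S - R) < e \<longrightarrow> bounded_below R"
proof -
  obtain c where c: "c > 0" "\<And>x. c * norm x \<le> norm (S x)"
    using assms by (auto simp: bounded_below_def)
  have "bounded_below R" if R: "norm (S - R) < c / 2" for R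
    unfolding bounded_below_def
  proof (intro exI[of _ "c / 2"] conjI allI)
    fix x
    have "norm ((S - R) x) \<le> c / 2 * norm x"
      using norm_blinfun[of "S - R" x] mult_right_mono[of "norm (S - R)" "c / 2" "norm x"] R by simp
    then have "norm (S x - R x) \<le> c / 2 * norm x"
      by (simp add: blinfun.diff_left)
    then show "c / 2 * norm x \<le> norm (R x)"
      using c(2)[of x] norm_triangle_ineq2[of "S x" "R x"] by simp
  qed (use c in simp)
  then show ?thesis using c(1) by (intro exI[of _ "c / 2"]) simp
qed

text \<open>Lax-Milgram inside \<open>A\<close>: coercivity makes the range closed and its
  orthogonal complement zero, and the inverse commutes with the commutant because \<open>N\<close>
  does.\<close>

lemma coercive_inverse:
  assumes N: "N \<in> A" and d: "d > 0" and pos: "\<And>z. d * (norm z)\<^sup>2 \<le> N z \<bullet> z"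
  obtains M where "M \<in> A" "\<And>x. M (N x) = x"
    "\<And>x. N (M x) = x"
proof -
  have below: "d * norm z \<le> norm (N z)" for z
  proof (cases "z = 0")
    case False
    have "d * norm z * norm z \<le> norm (N z) * norm z"
      using pos[of z] norm_cauchy_schwarz[of "N z" z] by (simp add: power2_eq_square)
    then show ?thesis using False by simp
  qed simp
  have "complete (range N)"
    by (rule complete_isometric_image[of d]) (use d below in \<open>auto simp: blinfun.bounded_linear_right complete_UNIV\<close>)
  then have cl: "closed (range N)" by (simp add: complete_eq_closed)
  have sub: "subspace (range N)"
    by (rule linear_subspace_image) (simp_all add: bounded_linear.linear blinfun.bounded_linear_right)
  have surj: "x \<in> range N" for x
  proof -
    obtain p where p: "p \<in> range N" "\<forall>m\<in>range N. (x - p) \<bullet> m = 0"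
      using orthogonal_decomposition_closed_subspace[OF sub cl, of x] by auto
    have "(x - p) \<bullet> N (x - p) = 0" using p(2) by simp
    then have "d * (norm (x - p))\<^sup>2 \<le> 0" using pos[of "x - p"] by (simp add: inner_commute)
    then have "x = p" using d by (simp add: mult_le_0_iff)
    then show ?thesis using p(1) by simp
  qed
  have inj: "x = y" if "N x = N y" for x y
    using below[of "x - y"] that d by (simp add: blinfun.diff_right mult_le_0_iff)
  obtain m where m: "\<And>x. N (m x) = x" using f_inv_into_f[OF surj] that by blast
  have "bounded_linear m"
  proof (rule bounded_linear_intro[where K = "1 / d"])
    show "m (x + y) = m x + m y" for x y by (rule inj) (simp add: m blinfun.add_right)
    show "m (r *\<^sub>R x) = r *\<^sub>R m x" for r x by (rule inj) (simp add: m blinfun.scaleR_right)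
    show "norm (m x) \<le> norm x * (1 / d)" for x using below[of "m x"] d by (simp add: m field_simps)
  qed
  then obtain M :: "'a \<Rightarrow>\<^sub>L 'a" where M: "\<And>x. M x = m x"
    by (metis bounded_linear_Blinfun_apply)
  have "M \<in> A"
    unfolding mem_iff_commutes
  proof (intro ballI allI)
    fix Y x assume "Y \<in> commutant A"
    then have "N (Y (m x)) = Y x"
      using N[unfolded mem_iff_commutes] by (simp add: m)
    then have "N (M (Y x)) = N (Y (M x))"
      by (simp add: M m)
    then show "M (Y x) = Y (M x)"
      by (rule inj)
  qed
  moreover have "m (N x) = x" for x by (rule inj[OF m])
  ultimately show ?thesis using that[of M] m by (simp add: M)
qed

text \<open>\<open>adj X o\<^sub>L X\<close> is coercive, and its inverse followed on the right by
  \<open>adj X\<close> is the left inverse.\<close>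

lemma bounded_below_imp_left_inverse:
  assumes X: "X \<in> A" and "bounded_below X"
  shows "\<exists>L\<in>A. \<forall>x. L (X x) = x"
proof -
  obtain c where c: "c > 0" "\<And>x. c * norm x \<le> norm (X x)"
    using assms by (auto simp: bounded_below_def)
  have pos: "c\<^sup>2 * (norm z)\<^sup>2 \<le> (adj X o\<^sub>L X) z \<bullet> z" for z
  proof -
    have "(c * norm z)\<^sup>2 \<le> (norm (X z))\<^sup>2" using c by (intro power_mono) auto
    then show ?thesis using X by (simp add: inner_adj(2) power_mult_distrib power2_norm_eq_inner)
  qed
  obtain M where "M \<in> A" "\<And>x. M ((adj X o\<^sub>L X) x) = x"
    by (rule coercive_inverse[OF _ _ pos]) (use X c(1) in \<open>auto intro: that\<close>)
  then show ?thesis using X by (intro bexI[of _ "M o\<^sub>L adj X"]) simp_all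
qed

text \<open>This makes invertibility stable under small perturbations. A left inverse of
  \<open>adj X\<close> is the adjoint of a right inverse of \<open>X\<close>, which must agree with
  the left inverse.\<close>

lemma invertible_in_iff_bounded_below:
  assumes X: "X \<in> A"
  shows "invertible_in A X \<longleftrightarrow> bounded_below X \<and> bounded_below (adj X)"
proof
  assume "invertible_in A X"
  then obtain R where R: "R \<in> A" "X o\<^sub>L R = id_blinfun" "R o\<^sub>L X = id_blinfun"
    by (auto simp: invertible_in_def)
  have "R (X x) = x" for x
    using R(3) by (metis blinfun_apply_blinfun_compose blinfun_apply_id_blinfun)
  moreover have "adj R o\<^sub>L adj X = id_blinfun"
    using adj_simps(6)[of X R] R X by (simp add: adj_simps(1))
  then have "adj R (adj X x) = x" for x
    by (metis blinfun_apply_blinfun_compose blinfun_apply_id_blinfun)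
  ultimately show "bounded_below X \<and> bounded_below (adj X)"
    using left_inverse_imp_bounded_below by blast
next
  assume bb: "bounded_below X \<and> bounded_below (adj X)"
  obtain L where L: "L \<in> A" "\<And>x. L (X x) = x"
    using bounded_below_imp_left_inverse[OF X] bb by auto
  obtain K where K: "K \<in> A" "\<And>x. K (adj X x) = x"
    using bounded_below_imp_left_inverse[of "adj X"] bb X by auto
  have "K o\<^sub>L adj X = id_blinfun" using K(2) by (intro blinfun_eqI) simp
  then have "X o\<^sub>L adj K = id_blinfun" using adj_simps(6)[of K "adj X"] K(1) X by (simp add: adj_simps(1,3))
  then have XK: "X (adj K x) = x" for x
    by (metis blinfun_apply_blinfun_compose blinfun_apply_id_blinfun)
  then have "X (L x) = x" for x using L(2) by metis
  then show "invertible_in A X" unfolding invertible_in_def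
    using L by (intro bexI[of _ L] conjI blinfun_eqI) simp_all
qed

text \<open>Baire's theorem applied to the closed sets \<open>{x. \<forall>w. \<bar>\<langle>w, x\<rangle>\<bar> \<le> k \<parallel>S\<^sup>* w\<parallel>}\<close>, which exhaust the space
  when \<open>S\<close> is surjective.\<close>

lemma surj_iff_adj_bounded_below:
  assumes S: "S \<in> A"
  shows "surj (blinfun_apply S) \<longleftrightarrow> bounded_below (adj S)"
proof
  assume "bounded_below (adj S)"
  then obtain L where L: "L \<in> A" "\<And>x. L (adj S x) = x"
    using bounded_below_imp_left_inverse[of "adj S"] S by auto
  have "L o\<^sub>L adj S = id_blinfun" using L(2) by (intro blinfun_eqI) simp
  then have "S o\<^sub>L adj L = id_blinfun" using adj_simps(6)[of L "adj S"] L(1) S by (simp add: adj_simps(1,3))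
  then show "surj (blinfun_apply S)"
    by (metis blinfun_apply_blinfun_compose blinfun_apply_id_blinfun surjI)
next
  assume surj: "surj (blinfun_apply S)"
  define C where "C k = {x. \<forall>w. \<bar>w \<bullet> x\<bar> \<le> real k * norm (adj S w)}" for k :: nat
  have clC: "closed (C k)" for k
    unfolding C_def by (intro closed_Collect_all closed_Collect_le continuous_intros)
  have "x \<in> (\<Union>k. C k)" for x
  proof -
    obtain u where u: "x = S u" using surj by blast
    obtain k where k: "norm u \<le> real k" using real_arch_simple by blast
    have "\<bar>w \<bullet> x\<bar> \<le> real k * norm (adj S w)" for w
    proof -
      have "\<bar>w \<bullet> x\<bar> = \<bar>adj S w \<bullet> u\<bar>" using S by (simp add: u inner_adj(2))
      also have "\<dots> \<le> norm (adj S w) * norm u" by (rule Cauchy_Schwarz_ineq2)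
      also have "\<dots> \<le> norm (adj S w) * real k" using k by (simp add: mult_left_mono)
      finally show ?thesis by (simp add: mult.commute)
    qed
    then show ?thesis by (auto simp: C_def)
  qed
  then have un: "(\<Union>k. C k) = UNIV" by blast
  have "\<exists>k. interior (C k) \<noteq> {}"
  proof (rule ccontr)
    assume "\<nexists>k. interior (C k) \<noteq> {}"
    then have "euclidean interior_of (\<Union>(range C)) = {}"
      using clC by (intro Baire_category_alt disjI1 completely_metrizable_space_euclidean) auto
    then show False using un by simp
  qed
  then obtain k x0 where "x0 \<in> interior (C k)" by blast
  then obtain r where r: "r > 0" "cball x0 r \<subseteq> C k" by (auto simp: mem_interior_cball)
  have est: "r * norm w \<le> 2 * real k * norm (adj S w)" for w
  proof (cases "w = 0")
    case False
    \<comment> \<open>Moving from the centre to the sphere in the direction of \<open>w\<close>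
      changes the pairing with \<open>w\<close> by \<open>r * norm w\<close>.\<close>
    let ?x = "x0 + (r / norm w) *\<^sub>R w"
    have "?x \<in> C k" "x0 \<in> C k" using r False by (auto simp: subset_iff dist_norm)
    then have "\<bar>w \<bullet> ?x\<bar> \<le> real k * norm (adj S w)"
      "\<bar>w \<bullet> x0\<bar> \<le> real k * norm (adj S w)" by (auto simp: C_def)
    moreover have "w \<bullet> ?x = w \<bullet> x0 + r * norm w"
      using False by (simp add: inner_add_right power2_norm_eq_inner[symmetric] power2_eq_square)
    ultimately show ?thesis by linarith
  qed simp
  show "bounded_below (adj S)"
    unfolding bounded_below_def
  \<comment> \<open>The added 1 covers \<open>k = 0\<close>.\<close>
  proof (intro exI[of _ "r / (2 * real k + 1)"] conjI allI)
    fix w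
    have "r * norm w \<le> (2 * real k + 1) * norm (adj S w)"
      using est[of w] by (simp add: algebra_simps add_increasing)
    then show "r / (2 * real k + 1) * norm w \<le> norm (adj S w)"
      by (simp add: field_simps add_pos_nonneg)
  qed (use r in simp)
qed


section \<open>Weyl operators\<close>

text \<open>One construction for both cases: a left inverse for upper semi-Weyl operators, and a
  two-sided one for Weyl operators, where \<open>P' = Q\<close>.\<close>

lemma decompose_invertible_up_to:
  assumes T: "T \<in> A" and PQ: "P \<in> Proj A" "Q \<in> Proj A" and fin: "P \<in> Proj0 A"
    and inv: "invertible_up_to A T P Q"
    and P': "P' \<in> Proj A" "proj_le P' Q" "mvn_equiv A P P'"
  shows "\<exists>S\<in>A. \<exists>F\<in>fin_ideal A. T = S + F \<and>
    (\<exists>L\<in>A. L o\<^sub>L S = id_blinfun \<and> (P' = Q \<longrightarrow> S o\<^sub>L L = id_blinfun))"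
proof -
  obtain B where B: "B \<in> A" "B = (id_blinfun - P) o\<^sub>L B o\<^sub>L (id_blinfun - Q)"
    "((id_blinfun - Q) o\<^sub>L T o\<^sub>L (id_blinfun - P)) o\<^sub>L B = id_blinfun - Q"
    "B o\<^sub>L ((id_blinfun - Q) o\<^sub>L T o\<^sub>L (id_blinfun - P)) = id_blinfun - P"
    using inv by (auto simp: invertible_up_to_def Let_def)
  note PD = Proj_D[OF PQ(1)] and QD = Proj_D[OF PQ(2)]
  have BQ: "B (Q x) = 0" and PB: "P (B x) = 0" for x
    by (subst B(2), simp add: blinfun.bilinear_simps PD QD)+
  have TB: "T (B x) + (Q x - Q (T (B x))) = x" for x
    using arg_cong[OF B(3), of "\<lambda>X. X x"]
    by (simp add: blinfun.bilinear_simps PB algebra_simps)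
  have BT: "B (T (x - P x)) = x - P x" for x
    using arg_cong[OF B(4), of "\<lambda>X. X x"]
    by (simp add: blinfun.bilinear_simps BQ)
  obtain V where V: "V \<in> A" "V o\<^sub>L adj V = P" "adj V o\<^sub>L V = P'"
    using P'(3) by (auto simp: mvn_equiv_def)
  note V = V partial_isometry_simps[OF V PQ(1) P'(1)]
  note le = proj_le_D[OF P'(1) PQ(2) P'(2)]
  have QV: "Q (adj V x) = adj V x" for x
    by (metis V(8) le(1))
  have VQ: "V (Q x) = V x" for x
    by (metis V(7) le(2))
  have BV: "B (adj V x) = 0" for x by (metis QV BQ)
  have VB: "adj V (B x) = 0" for x by (metis V(9) PB blinfun.zero_right)
  define S where "S = (T o\<^sub>L (id_blinfun - P)) + adj V"
  \<comment> \<open>The second factor removes from \<open>S x\<close> the \<open>Q\<close>-component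
    of \<open>T (x - P x)\<close>, which \<open>V\<close> would otherwise see; then \<open>B\<close>
    recovers \<open>x - P x\<close> and \<open>V\<close> recovers \<open>P x\<close>.\<close>
  define L where "L = (B + V) o\<^sub>L (id_blinfun - (Q o\<^sub>L T o\<^sub>L B))"
  have mem: "S \<in> A" "L \<in> A" using T B(1) V(1) PD(1) QD(1) by (simp_all add: S_def L_def)
  have "L o\<^sub>L S = id_blinfun"
  proof (rule blinfun_eqI)
    fix x
    let ?y = "T (x - P x)"
    have "S x = ?y + adj V x" by (simp add: S_def blinfun.bilinear_simps)
    then have "(id_blinfun - (Q o\<^sub>L T o\<^sub>L B)) (S x)
        = ?y + adj V x - Q ?y"
      by (simp add: blinfun.diff_left blinfun.add_right BT BV)
    then show "(L o\<^sub>L S) x = blinfun_apply id_blinfun x"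
      by (simp add: L_def blinfun.add_left blinfun.add_right[of B] blinfun.add_right[of V]
          blinfun.diff_right[of B _ "Q _"] blinfun.diff_right[of V _ "Q _"]
          BT BV BQ VQ V)
  qed
  \<comment> \<open>\<open>T B\<close> is the identity modulo the range of \<open>Q\<close>; when
    \<open>P' = Q\<close>, \<open>adj V\<close> after \<open>V\<close> supplies exactly the missing
    \<open>Q\<close>-component.\<close>
  moreover have "S o\<^sub>L L = id_blinfun" if "P' = Q"
  proof (rule blinfun_eqI)
    fix x
    let ?t = "T (B x)"
    have Lx: "L x = B x + V (x - ?t)"
      by (simp add: L_def blinfun.bilinear_simps BQ VQ)
    then have "L x - P (L x) = B x"
      by (simp add: blinfun.add_right PB V)
    moreover have "adj V (L x) = Q (x - ?t)"
      unfolding Lx using that by (simp add: blinfun.add_right VB V)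
    ultimately show "(S o\<^sub>L L) x = blinfun_apply id_blinfun x"
      using TB[of x] by (simp add: S_def blinfun.add_left blinfun.diff_left blinfun.diff_right[of Q])
  qed
  moreover have "T - S \<in> fin_ideal A"
  proof (rule fin_idealI[OF _ fin])
    show "T - S \<in> A" using T mem by simp
    show "(T - S) x = 0" if "P x = 0" for x
      using that V(9)[of x] by (simp add: S_def blinfun.bilinear_simps)
  qed
  ultimately show ?thesis using mem by (intro bexI[of _ S] bexI[of _ "T - S"] conjI bexI[of _ L]) auto
qed

lemma upper_semi_weyl_decompose:
  assumes T: "T \<in> A" and "upper_semi_weyl A T"
  shows "\<exists>S\<in>A. \<exists>F\<in>fin_ideal A. bounded_below S \<and> T = S + F"
proof -
  obtain P Q P' where *: "P \<in> Proj A" "Q \<in> Proj A" "P \<in> Proj0 A" "invertible_up_to A T P Q"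
    "P' \<in> Proj A" "proj_le P' Q" "mvn_equiv A P P'"
    using assms(2) by (auto simp: upper_semi_weyl_def mvn_le_def)
  obtain S F L where SF: "S \<in> A" "F \<in> fin_ideal A" "T = S + F" "L o\<^sub>L S = id_blinfun"
    using decompose_invertible_up_to[OF T *] by blast
  have "L (S x) = x" for x
    using SF(4) by (metis blinfun_apply_blinfun_compose blinfun_apply_id_blinfun)
  then have "bounded_below S" by (rule left_inverse_imp_bounded_below)
  then show ?thesis using SF by blast
qed

lemma weyl_decompose:
  assumes T: "T \<in> A" and "weyl A T"
  shows "\<exists>S\<in>A. \<exists>F\<in>fin_ideal A. invertible_in A S \<and> T = S + F"
proof -
  obtain P Q where *: "P \<in> Proj A" "Q \<in> Proj A" "P \<in> Proj0 A" "invertible_up_to A T P Q" "mvn_equiv A P Q"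
    using assms(2) by (auto simp: weyl_def)
  have "proj_le Q Q" by (simp add: proj_le_def)
  then show ?thesis
    using decompose_invertible_up_to[OF T *(1-4) *(2) _ *(5)] unfolding invertible_in_def by metis
qed

text \<open>The complement of \<open>Q\<close> is the range of \<open>X = T (1 - P)\<close>.
  Compressing the bounded below operator \<open>R\<close> to a map from \<open>P H\<close> to
  \<open>Q H\<close> keeps it injective, and its polar decomposition embeds \<open>P\<close> into
  \<open>Q\<close>.\<close>

lemma upper_semi_weyl_if_bounded_below:
  assumes T: "T \<in> A" and S: "S \<in> A" "bounded_below S" and F: "F \<in> fin_ideal A" and TSF: "T = S + F"
  shows "upper_semi_weyl A T"
proof -
  obtain e where e: "e > 0" "\<And>R. norm (S - R) < e \<Longrightarrow> bounded_below R"
    using bounded_below_perturb[OF S(2)] by blast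
  obtain F0 Q0 where F0: "F0 \<in> A" "Q0 \<in> Proj0 A"
    "range Q0 = closure (range F0)" "norm (F - F0) < e"
    by (rule fin_ideal_approx[OF F e(1)]) (rule that)
  \<comment> \<open>\<open>R = S + (F - F0)\<close> lies within \<open>e\<close> of
    \<open>S\<close>.\<close>
  define R where "R = T - F0"
  have R: "R \<in> A" using T F0(1) by (simp add: R_def)
  have "bounded_below R" using F0(4) by (intro e(2)) (simp add: R_def TSF norm_minus_commute)
  then obtain c where c: "c > 0" "\<And>x. c * norm x \<le> norm (R x)" by (auto simp: bounded_below_def)
  have Rinj: "x = 0" if "R x = 0" for x using c(2)[of x] that c(1) by (simp add: mult_le_0_iff)
  obtain P where P: "P \<in> Proj0 A" "\<And>x. P x = 0 \<longleftrightarrow> F0 x = 0"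
    using initial_support_finite[OF F0(1-3)] by blast
  have PP: "P \<in> Proj A" using P(1) by (simp add: Proj0_def)
  note PD = Proj_D[OF PP]
  define X where "X = R o\<^sub>L (id_blinfun - P)"
  have X: "X \<in> A" using R PD(1) by (simp add: X_def)
  have XP: "X (P x) = 0" for x
    by (simp add: X_def blinfun.bilinear_simps PD)
  have PX: "P (adj X x) = 0" for x
    by (rule vector_eq_ldot[THEN iffD1]) (use X in \<open>simp add: PD(3)[symmetric] inner_adj(1)[symmetric] XP\<close>)
  have TX: "T (x - P x) = X x" for x
  proof -
    have "F0 (x - P x) = 0"
      using P(2)[of "x - P x"] by (simp add: blinfun.diff_right PD)
    then show ?thesis by (simp add: X_def R_def blinfun.diff_left)
  qed
  \<comment> \<open>\<open>adj X o\<^sub>L X\<close> is coercive only on the kernel of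
    \<open>P\<close>; adding \<open>P\<close> makes it coercive everywhere, with the smaller of the
    constants \<open>c\<^sup>2\<close> and 1.\<close>
  define N where "N = (adj X o\<^sub>L X) + P"
  have N: "N \<in> A" using X PD(1) by (simp add: N_def)
  define d where "d = min (c\<^sup>2) 1"
  have d: "d > 0" using c(1) by (simp add: d_def)
  have pos: "d * (norm z)\<^sup>2 \<le> N z \<bullet> z" for z
  proof -
    let ?u = "z - P z"
    have "(c * norm ?u)\<^sup>2 \<le> (norm (X z))\<^sup>2"
      using c by (intro power_mono) (auto simp: X_def blinfun.diff_left)
    then have "d * (norm ?u)\<^sup>2 \<le> (norm (X z))\<^sup>2"
      by (smt (verit) d_def mult_right_mono power_mult_distrib zero_le_power2)
    moreover have "d * (norm (P z))\<^sup>2 \<le> (norm (P z))\<^sup>2"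
      by (simp add: d_def mult_left_le_one_le)
    moreover have "(norm z)\<^sup>2 = (norm ?u)\<^sup>2 + (norm (P z))\<^sup>2"
      unfolding power2_norm_eq_inner by (simp add: inner_simps PD inner_commute)
    moreover have "N z \<bullet> z = (norm (X z))\<^sup>2 + (norm (P z))\<^sup>2"
      using X by (simp add: N_def blinfun.add_left inner_add_left inner_adj(2) power2_norm_eq_inner PD)
    ultimately show ?thesis by (simp add: distrib_left)
  qed
  obtain M where M: "M \<in> A" "\<And>x. M (N x) = x"
    "\<And>x. N (M x) = x"
    by (rule coercive_inverse[OF N d pos]) (rule that)
  have NP: "N (P x) = P x" for x
    by (simp add: N_def blinfun.add_left XP PD blinfun.zero_right)
  then have MP: "M (P x) = P x" for x using M(2) by metis
  have PN: "P (N x) = P x" for x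
    by (simp add: N_def blinfun.add_left blinfun.add_right PX PD)
  then have PM: "P (M x) = P x" for x using M(3) by metis
  have Nsa: "N x \<bullet> y = x \<bullet> N y" for x y
    using X by (simp add: N_def blinfun.add_left inner_simps inner_adj(1) adj_simps(3) PD)
  have Msa: "M x \<bullet> y = x \<bullet> M y" for x y
    using Nsa[of "M x" "M y"] by (simp add: M(3))
  \<comment> \<open>The Moore-Penrose inverse of \<open>X\<close>: \<open>X B\<close> is the
    orthogonal projection onto the range of \<open>X\<close>, and \<open>B X\<close> is
    \<open>1 - P\<close>.\<close>
  define B where "B = M o\<^sub>L adj X"
  have B: "B \<in> A" using M(1) X by (simp add: B_def)
  have BX: "B (X x) = x - P x" for x
  proof -
    have "adj X (X x) = N x - P x"
      by (simp add: N_def blinfun.add_left)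
    then show ?thesis by (simp add: B_def blinfun.diff_right M MP)
  qed
  have PB: "P (B x) = 0" for x
    by (simp add: B_def PM PX)
  have XPx: "X (x - P x) = X x" for x
    by (simp add: blinfun.diff_right XP)
  define Q where "Q = id_blinfun - (X o\<^sub>L B)"
  have E: "X o\<^sub>L B \<in> Proj A"
  proof (rule Proj_I)
    show "X o\<^sub>L B \<in> A" using X B by simp
    show "(X o\<^sub>L B) ((X o\<^sub>L B) x) = (X o\<^sub>L B) x" for x
      by (simp add: BX XPx)
    show "(X o\<^sub>L B) x \<bullet> y = x \<bullet> (X o\<^sub>L B) y" for x y
      using X by (simp add: B_def inner_adj(1) Msa adj_simps(3))
  qed
  have Q: "Q \<in> Proj A" unfolding Q_def using E by (rule Proj_compl)
  note QD = Proj_D[OF Q]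
  have Qx: "Q x = x - X (B x)" for x
    by (simp add: Q_def blinfun.diff_left)
  have BXB: "B (X (B x)) = B x" for x
    by (simp add: BX PB)
  have T': "(id_blinfun - Q) o\<^sub>L T o\<^sub>L (id_blinfun - P) = X"
    by (rule blinfun_eqI) (simp add: blinfun.diff_left TX Qx BX XPx)
  have inv: "invertible_up_to A T P Q"
    unfolding invertible_up_to_def Let_def T'
  proof (intro bexI[of _ B] conjI)
    show "B = (id_blinfun - P) o\<^sub>L B o\<^sub>L (id_blinfun - Q)"
      by (rule blinfun_eqI) (simp add: blinfun.diff_left Qx BXB PB)
    show "X o\<^sub>L B = id_blinfun - Q" by (simp add: Q_def)
    show "B o\<^sub>L X = id_blinfun - P"
      by (rule blinfun_eqI) (simp add: blinfun.diff_left BX)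
  qed (rule B)
  define X2 where "X2 = Q o\<^sub>L R o\<^sub>L P"
  have X2: "X2 \<in> A" using QD(1) R PD(1) by (simp add: X2_def)
  obtain V where V: "V \<in> A" "adj V o\<^sub>L V \<in> Proj A" "V o\<^sub>L adj V \<in> Proj A"
    "range ((V o\<^sub>L adj V)) = closure (range X2)"
    "\<And>z. (adj V o\<^sub>L V) z = 0 \<longleftrightarrow> X2 z = 0"
    by (rule polar_decomposition[OF X2]) (rule that)
  have "X2 z = 0 \<longleftrightarrow> P z = 0" for z
  proof
    assume "X2 z = 0"
    \<comment> \<open>If \<open>Q\<close> kills \<open>R (P z)\<close>, this vector lies in the
      range of \<open>R (1 - P)\<close>; injectivity of \<open>R\<close> then puts
      \<open>P z\<close> in the kernel of \<open>P\<close>.\<close>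
    then have "R (P z) = X (B (R (P z)))"
      by (simp add: X2_def Qx)
    then obtain w where "R (P z) = R (w - P w)"
      by (auto simp: X_def blinfun.diff_left)
    then have "R (P z - (w - P w)) = 0"
      by (simp add: blinfun.diff_right)
    then have "P z - (w - P w) = 0" by (rule Rinj)
    then have "P (P z - (w - P w)) = 0" by simp
    then show "P z = 0" by (simp add: blinfun.diff_right PD)
  qed (simp add: X2_def)
  then have VP: "adj V o\<^sub>L V = P" by (intro Proj_eqI_ker[OF V(2) PP]) (simp only: V(5))
  have "mvn_le A P Q"
    unfolding mvn_le_def
  proof (intro bexI[OF _ V(3)] conjI)
    show "mvn_equiv A P (V o\<^sub>L adj V)"
      using V(1) VP mvn_equiv_sym[of "V o\<^sub>L adj V" P] by (auto simp: mvn_equiv_def)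
    show "proj_le (V o\<^sub>L adj V) Q"
      unfolding proj_le_def V(4) by (intro closure_minimal closed_range_Proj Q) (auto simp: X2_def)
  qed
  then show ?thesis unfolding upper_semi_weyl_def
    using PP Q inv P(1) by (intro bexI[of _ P] bexI[of _ Q]) simp_all
qed

text \<open>For an invertible \<open>R = T - F0\<close> with inverse \<open>K\<close>, the operator
  \<open>K Q\<close> has the kernel of \<open>Q\<close>, so its range projection \<open>P\<close> is
  equivalent to \<open>Q\<close>. Since \<open>R\<close> maps \<open>P H\<close> into
  \<open>Q H\<close>, compressing \<open>K\<close> inverts the compression of
  \<open>T\<close>.\<close>

lemma weyl_if_invertible:
  assumes T: "T \<in> A" and S: "S \<in> A" "invertible_in A S" and F: "F \<in> fin_ideal A" and TSF: "T = S + F"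
  shows "weyl A T"
proof -
  have bb: "bounded_below S" "bounded_below (adj S)"
    using S invertible_in_iff_bounded_below[of S] by simp_all
  obtain e where e: "e > 0" "\<And>R. norm (S - R) < e \<Longrightarrow> bounded_below R"
    using bounded_below_perturb[OF bb(1)] by blast
  obtain e' where e': "e' > 0" "\<And>R. norm (adj S - R) < e' \<Longrightarrow> bounded_below R"
    using bounded_below_perturb[OF bb(2)] by blast
  \<comment> \<open>The smaller radius keeps both \<open>R\<close> and \<open>adj R\<close> bounded
    below.\<close>
  have "min e e' > 0" using e e' by simp
  then obtain F0 Q where F0: "F0 \<in> A" "Q \<in> Proj0 A"
    "range Q = closure (range F0)" "norm (F - F0) < min e e'"
    by (rule fin_ideal_approx[OF F]) (rule that)
  define R where "R = T - F0"
  have R: "R \<in> A" using T F0(1) by (simp add: R_def)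
  have n: "norm (S - R) < min e e'" using F0(4) by (simp add: R_def TSF norm_minus_commute)
  have "bounded_below R" using n by (intro e(2)) simp
  moreover have "bounded_below (adj R)"
    using n norm_adj[of "S - R"] S(1) R by (intro e'(2)) (simp add: adj_simps)
  ultimately have "invertible_in A R" using R invertible_in_iff_bounded_below[of R] by simp
  then obtain K where K: "K \<in> A" "R o\<^sub>L K = id_blinfun" "K o\<^sub>L R = id_blinfun"
    by (auto simp: invertible_in_def)
  have RK: "R (K x) = x" "K (R x) = x" for x
    using K by (metis blinfun_apply_blinfun_compose blinfun_apply_id_blinfun)+
  have Q: "Q \<in> Proj A" using F0(2) by (simp add: Proj0_def)
  note QD = Proj_D[OF Q]
  have "K o\<^sub>L Q \<in> A" using K(1) QD(1) by simp
  then obtain V where V: "V \<in> A" "adj V o\<^sub>L V \<in> Proj A" "V o\<^sub>L adj V \<in> Proj A"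
    "range ((V o\<^sub>L adj V)) = closure (range ((K o\<^sub>L Q)))"
    "\<And>z. (adj V o\<^sub>L V) z = 0 \<longleftrightarrow> (K o\<^sub>L Q) z = 0"
    by (rule polar_decomposition) (rule that)
  define P where "P = V o\<^sub>L adj V"
  have P: "P \<in> Proj A" using V(3) by (simp add: P_def)
  note PD = Proj_D[OF P]
  have "(K o\<^sub>L Q) z = 0 \<longleftrightarrow> Q z = 0" for z
    using RK(1)[of "Q z"] by auto
  then have "adj V o\<^sub>L V = Q" by (intro Proj_eqI_ker[OF V(2) Q]) (simp only: V(5))
  then have PQ: "mvn_equiv A P Q" using V(1) by (auto simp: mvn_equiv_def P_def)
  then have P0: "P \<in> Proj0 A" using Proj0_equiv[OF P F0(2)] by blast
  have rP: "range P = closure (range ((K o\<^sub>L Q)))" using V(4) by (simp add: P_def)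
  have PKQ: "P (K (Q x)) = K (Q x)" for x
    unfolding PD(5)[symmetric] rP by (rule subsetD[OF closure_subset]) auto
  \<comment> \<open>\<open>R K Q = Q\<close> settles vectors in the range of \<open>K Q\<close>; the
    condition is closed.\<close>
  have QRP: "Q (R (P x)) = R (P x)" for x
  proof -
    have "closure (range ((K o\<^sub>L Q))) \<subseteq> {y. Q (R y) = R y}"
      by (intro closure_minimal closed_Collect_eq continuous_intros) (auto simp: RK QD)
    then show ?thesis using rP by blast
  qed
  have QF: "Q (F0 x) = F0 x" for x
    unfolding QD(5)[symmetric] F0(3) by (rule subsetD[OF closure_subset]) auto
  have Tx: "T x = R x + F0 x" for x
    by (simp add: R_def blinfun.diff_left)
  \<comment> \<open>\<open>1 - Q\<close> annihilates both \<open>F0\<close> and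
    \<open>R P\<close>.\<close>
  have T': "(id_blinfun - Q) o\<^sub>L T o\<^sub>L (id_blinfun - P) = (id_blinfun - Q) o\<^sub>L R"
    by (rule blinfun_eqI) (simp add: Tx blinfun.bilinear_simps QF QRP)
  define B where "B = (id_blinfun - P) o\<^sub>L K o\<^sub>L (id_blinfun - Q)"
  have "invertible_up_to A T P Q"
    unfolding invertible_up_to_def Let_def T'
  proof (intro bexI[of _ B] conjI)
    show "B = (id_blinfun - P) o\<^sub>L B o\<^sub>L (id_blinfun - Q)"
      by (rule blinfun_eqI) (simp add: B_def blinfun.bilinear_simps PD QD)
    show "((id_blinfun - Q) o\<^sub>L R) o\<^sub>L B = id_blinfun - Q"
      by (rule blinfun_eqI) (simp add: B_def blinfun.bilinear_simps PD QD RK QRP)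
    show "B o\<^sub>L ((id_blinfun - Q) o\<^sub>L R) = id_blinfun - P"
      by (rule blinfun_eqI) (simp add: B_def blinfun.bilinear_simps PD QD RK PKQ)
    show "B \<in> A" using PD(1) QD(1) K(1) by (simp add: B_def)
  qed
  then show ?thesis unfolding weyl_def
    using P Q P0 F0(2) PQ by (intro bexI[of _ P] bexI[of _ Q]) simp_all
qed

section \<open>Duality between upper and lower semi-Weyl operators\<close>

lemma invertible_up_to_adj:
  assumes T: "T \<in> A" and P: "P \<in> Proj A" and Q: "Q \<in> Proj A" and inv: "invertible_up_to A T P Q"
  shows "invertible_up_to A (adj T) Q P"
proof -
  define T' where "T' = (id_blinfun - Q) o\<^sub>L T o\<^sub>L (id_blinfun - P)"
  obtain B where B: "B \<in> A" "B = (id_blinfun - P) o\<^sub>L B o\<^sub>L (id_blinfun - Q)"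
    "T' o\<^sub>L B = id_blinfun - Q" "B o\<^sub>L T' = id_blinfun - P"
    using inv by (auto simp: invertible_up_to_def Let_def T'_def)
  note PD = Proj_D[OF P] and QD = Proj_D[OF Q]
  have T'A: "T' \<in> A" using T PD(1) QD(1) by (simp add: T'_def)
  have adjT': "(id_blinfun - P) o\<^sub>L adj T o\<^sub>L (id_blinfun - Q) = adj T'"
    using T PD(1,4) QD(1,4) by (simp add: T'_def adj_simps bounded_ops_closed) (simp add: blinfun_eq_pointwise)
  have "adj B = adj ((id_blinfun - P) o\<^sub>L B o\<^sub>L (id_blinfun - Q))" using B(2) by simp
  also have "\<dots> = (id_blinfun - Q) o\<^sub>L adj B o\<^sub>L (id_blinfun - P)"
    using B(1) PD(1,4) QD(1,4) by (simp add: adj_simps bounded_ops_closed) (simp add: blinfun_eq_pointwise)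
  finally have 1: "adj B = (id_blinfun - Q) o\<^sub>L adj B o\<^sub>L (id_blinfun - P)" .
  have 2: "adj T' o\<^sub>L adj B = id_blinfun - P"
    using arg_cong[OF B(4), of adj] B(1) T'A PD(1,4) by (simp add: adj_simps)
  have 3: "adj B o\<^sub>L adj T' = id_blinfun - Q"
    using arg_cong[OF B(3), of adj] B(1) T'A QD(1,4) by (simp add: adj_simps)
  show ?thesis
    unfolding invertible_up_to_def Let_def adjT'
    using 1 2 3 B(1) by (intro bexI[of _ "adj B"] conjI) simp_all
qed

lemma lower_semi_weyl_iff_adj:
  assumes T: "T \<in> A"
  shows "lower_semi_weyl A T \<longleftrightarrow> upper_semi_weyl A (adj T)"
proof
  assume "lower_semi_weyl A T"
  then show "upper_semi_weyl A (adj T)"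
    unfolding lower_semi_weyl_def upper_semi_weyl_def using invertible_up_to_adj[OF T] by blast
next
  assume "upper_semi_weyl A (adj T)"
  then show "lower_semi_weyl A T"
    unfolding lower_semi_weyl_def upper_semi_weyl_def
    using invertible_up_to_adj[of "adj T"] T by (simp add: adj_simps) blast
qed

text \<open>The adjoint preserves \<open>A\<close> and \<open>fin_ideal A\<close> and exchanges
  surjective operators with those bounded below.\<close>

lemma surj_decomposition_iff_adj:
  assumes T: "T \<in> A"
  shows "(\<exists>S\<in>A. \<exists>F\<in>fin_ideal A. surj (blinfun_apply S) \<and> T = S + F) \<longleftrightarrow>
         (\<exists>S\<in>A. \<exists>F\<in>fin_ideal A. bounded_below S \<and> adj T = S + F)"
proof
  assume "\<exists>S\<in>A. \<exists>F\<in>fin_ideal A. surj (blinfun_apply S) \<and> T = S + F"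
  then obtain S F where "S \<in> A" "F \<in> fin_ideal A" "surj (blinfun_apply S)" "T = S + F" by blast
  then show "\<exists>S\<in>A. \<exists>F\<in>fin_ideal A. bounded_below S \<and> adj T = S + F"
    using fin_ideal_subset[of F] fin_ideal_adj[of F] surj_iff_adj_bounded_below[of S]
    by (intro bexI[of _ "adj S"] bexI[of _ "adj F"]) (simp_all add: adj_simps)
next
  assume "\<exists>S\<in>A. \<exists>F\<in>fin_ideal A. bounded_below S \<and> adj T = S + F"
  then obtain S F where SF: "S \<in> A" "F \<in> fin_ideal A" "bounded_below S" "adj T = S + F" by blast
  have "T = adj (S + F)" using T SF(4) by (metis adj_simps(3) bounded_op)
  then show "\<exists>S\<in>A. \<exists>F\<in>fin_ideal A. surj (blinfun_apply S) \<and> T = S + F"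
    using SF fin_ideal_subset[of F] fin_ideal_adj[of F] surj_iff_adj_bounded_below[of "adj S"]
    by (intro bexI[of _ "adj S"] bexI[of _ "adj F"]) (simp_all add: adj_simps)
qed

end

theorem corollary4p9:
  fixes A :: "('a::chilbert_space \<Rightarrow>\<^sub>L 'a) set"
    and T :: "'a \<Rightarrow>\<^sub>L 'a"
  assumes "von_neumann_algebra A"
    and "properly_infinite A"
    and "T \<in> A"
  shows "(upper_semi_weyl A T \<longleftrightarrow>
            (\<exists>S\<in>A. \<exists>F\<in>fin_ideal A. bounded_below S \<and> T = S + F)) \<and>
         (lower_semi_weyl A T \<longleftrightarrow>
            (\<exists>S\<in>A. \<exists>F\<in>fin_ideal A. surj (blinfun_apply S) \<and> T = S + F)) \<and>
         (weyl A T \<longleftrightarrow>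
            (\<exists>S\<in>A. \<exists>F\<in>fin_ideal A. invertible_in A S \<and> T = S + F))"
proof -
  interpret vN_algebra A by standard (rule assms(1))
  \<comment> \<open>Stated for arbitrary \<open>X\<close> so that it applies to \<open>T\<close>
    and, for the lower case, to \<open>adj T\<close>.\<close>
  have upper: "upper_semi_weyl A X \<longleftrightarrow> (\<exists>S\<in>A. \<exists>F\<in>fin_ideal A. bounded_below S \<and> X = S + F)"
    if "X \<in> A" for X
    using upper_semi_weyl_decompose[OF that] upper_semi_weyl_if_bounded_below[OF that] by blast
  have "lower_semi_weyl A T \<longleftrightarrow> (\<exists>S\<in>A. \<exists>F\<in>fin_ideal A. surj (blinfun_apply S) \<and> T = S + F)"
    unfolding lower_semi_weyl_iff_adj[OF assms(3)] surj_decomposition_iff_adj[OF assms(3)]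
    using assms(3) by (intro upper) simp
  moreover have "weyl A T \<longleftrightarrow> (\<exists>S\<in>A. \<exists>F\<in>fin_ideal A. invertible_in A S \<and> T = S + F)"
    using weyl_decompose[OF assms(3)] weyl_if_invertible[OF assms(3)] by blast
  ultimately show ?thesis using upper[OF assms(3)] by blast
qed

end
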